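(* Suppose that the problem of minimizing $f(x)$ subject to $Ax=b$ is pathological (in the sense defined in the context). Then for any initialization $v^0\in\mathbf{R}^n$ and any hyperparameters $\eta>0$, $D>0$, $\epsilon>0$, $R\in\{1,2,\dots\}$, $M_{\max}\in\{0,1,2,\dots\}$, the difference $v^k-v^{k+1}$ of successive A2DR iterates converges to some nonzero vector $\delta v\in\mathbf{R}^n$. If, furthermore, $\lim_{k\to\infty}Ax^{k+1/2}=b$, then the problem is unbounded, in which case $$\|\delta v\|_2=t\,\mathrm{dist}(\mathrm{dom} f^*,\mathrm{range}(A^T)).$$ Otherwise, the problem is infeasible and $$\|\delta v\|_2\ge \mathrm{dist}(\mathrm{dom} f,\{x: Ax=b\}),$$ with equality when the dual problem is feasible.
   Context: **Problem.** Minimize $f(x)$ subject to $Ax=b$, with variable $x=(x_1,\dots,x_N)\in\mathbf{R}^n$, $x_i\in\mathbf{R}^{n_i}$, $n=\sum_i n_i$. Here $f(x)=\sum_{i=1}^N f_i(x_i)$, each $f_i:\mathbf{R}^{n_i}\to\mathbf{R}\cup\{+\infty\}$ is convex, closed and proper, $A=[A_1\ \cdots\ A_N]\in\mathbf{R}^{m\times n}$, $b\in\mathbf{R}^m$, and the linear system $Ax=b$ is assumed feasible. The problem is infeasible if $\mathrm{dom} f\cap\{x:Ax=b\}=\emptyset$, and unbounded if it is feasible but $\inf_{Ax=b}f(x)=-\infty$. **Pathological.** Let $f^*(y)=\sup_{x\in\mathrm{dom} f}(y^Tx-f(x))$, and for sets $C,C'$ let $\mathrm{dist}(C,C')=\inf\{\|c-c'\|_2: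 c\in C, c'\in C'\}$. The problem is primal strongly infeasible if $\mathrm{dist}(\mathrm{dom} f,\{x: Ax=b\})>0$, and dual strongly infeasible if $\mathrm{dist}(\mathrm{dom} f^*,\mathrm{range}(A^T))>0$. It is pathological if it is primal or dual strongly infeasible. **Dual problem.** Minimize over $\nu$ the function $f^*(\nu)+g^*(-\nu)$, where $g^*(\nu)=b^T\lambda$ when $\nu=A^T\lambda$ and $g^*(\nu)=+\infty$ otherwise. It is feasible if $\mathrm{dom} f^*\cap\mathrm{range}(A^T)\neq\emptyset$. **DRS mapping.** Fix $t>0$. Let $\mathrm{prox}_{tf}(v)=\mathrm{argmin}_x\,(f(x)+\frac1{2t}\|x-v\|_2^2)$ and $\Pi(v)=v-A^\dagger(Av-b)$ (projection onto $\{x:Ax=b\}$; $A^\dagger$ is the pseudoinverse). Define $F_{\rm DRS}(v)=v+\Pi(2\,\mathrm{prox}_{tf}(v)-v)-\mathrm{prox}_{tf}(v)$. **A2DR algorithm.** Inputs: $v^0\in\mathbf{R}^n$, $t>0$, $\eta>0$, $D>0$, $\epsilon>0$, $R\in\{1,2,\dots\}$, $M_{\max}\in\{0,1,2,\dots\}$. Initialize $n_{\rm AA}=0$, $R_{\rm AA}=0$, $I=\text{True}$. Set $v^1=v_{\rm DRS}^1=F_{\rm DRS}(v^0)$, $g^0=v^0-v^1$. For $k=1,2,\dots$: 1. Set $M^k=\min(M_{\max},k)$, $v_{\rm DRS}^{k+1}=F_{\rm DRS}(v^k)$, $g^k=v^k-v_{\rm DRS}^{k+1}$. 2. With $y^j=g^{j+1}-g^j$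 and $s^j=v^{j+1}-v^j$, set $Y_k=[y^{k-M^k}\ \cdots\ y^{k-1}]$, $S_k=[s^{k-M^k}\ \cdots\ s^{k-1}]$. 3. Let $\gamma^k=(\gamma^k_0,\dots,\gamma^k_{M^k-1})$ minimize $\|g^k-Y_k\gamma\|_2^2+\eta(\|S_k\|_F^2+\|Y_k\|_F^2)\|\gamma\|_2^2$ over $\gamma$ (if $S_k=Y_k=0$ any choice gives the same $v_{\rm AA}^{k+1}$ below). Set $\alpha_0^k=\gamma_0^k$, $\alpha_i^k=\gamma_i^k-\gamma_{i-1}^k$ for $1\le i\le M^k-1$, $\alpha_{M^k}^k=1-\gamma_{M^k-1}^k$ (if $M^k=0$, $\alpha^k_0=1$). 4. AA candidate: $v_{\rm AA}^{k+1}=\sum_{j=0}^{M^k}\alpha_j^k v_{\rm DRS}^{k-M^k+j+1}$. 5. Safeguard. If $I$ is True or $R_{\rm AA}\ge R$: if $\|g^k\|_2\le D\|g^0\|_2(n_{\rm AA}/R+1)^{-(1+\epsilon)}$, set $v^{k+1}=v_{\rm AA}^{k+1}$, $n_{\rm AA}\leftarrow n_{\rm AA}+1$, $I=\text{False}$, $R_{\rm AA}=1$; otherwise set $v^{k+1}=v_{\rm DRS}^{k+1}$, $R_{\rm AA}=0$, $I=\text{True}$. If instead $I$ is False and $R_{\rm AA}<R$: set $v^{k+1}=v_{\rm AA}^{k+1}$, $n_{\rm AA}\leftarrow n_{\rm AA}+1$, $R_{\rm AA}\leftarrow R_{\rm AA}+1$. The algorithm is run without a stopping test, producing infinite sequences.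 Also $x^{k+1/2}=\mathrm{prox}_{tf}(v^k)$.
   Formalization: In the case Ax^{k+1/2} → b, "the problem is unbounded" is claimed only if the problem is not infeasible with dist(dom f, {x: Ax=b}) = 0; there the claim is false, e.g. f(x,y) = -x on {x>0, xy≥1} with constraint y=0. The norm formula is kept in all cases. *)

theory Defs
  imports "HOL-Analysis.Analysis"
begin

section \<open>Extended-valued convex functions\<close>

definition effective_domain :: "('a \<Rightarrow> ereal) \<Rightarrow> 'a set" where
  "effective_domain f = {x. f x < \<infinity>}"

text \<open>
  Convex, closed and proper for a function on the subspace \<open>V\<close> with values in
  \<open>\<real> \<union> {+\<infinity>}\<close>. Convexity and closedness are those of the epigraph; the library constant
  \<open>epigraph\<close> covers only real-valued functions.
\<close>
definition closed_convex_proper_on ::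
    "'a::euclidean_space set \<Rightarrow> ('a \<Rightarrow> ereal) \<Rightarrow> bool" where
  "closed_convex_proper_on V f \<longleftrightarrow>
     (\<forall>x\<in>V. f x \<noteq> -\<infinity>) \<and> (\<exists>x\<in>V. f x < \<infinity>) \<and>
     convex {(x, r::real). x \<in> V \<and> f x \<le> ereal r} \<and>
     closed {(x, r::real). x \<in> V \<and> f x \<le> ereal r}"

definition conjugate :: "('a::euclidean_space \<Rightarrow> ereal) \<Rightarrow> 'a \<Rightarrow> ereal" where
  "conjugate f y = (SUP x\<in>effective_domain f. ereal (y \<bullet> x) - f x)"

section \<open>Separable objective\<close>

text \<open>
  The splitting \<open>x = (x\<^sub>1, \<dots>, x\<^sub>N)\<close> of \<open>\<real>\<^sup>n\<close> is given by a map \<open>blk\<close> sending each of the \<open>n\<close>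
  coordinates to the block containing it, with \<open>N = CARD('b)\<close> and \<open>n\<^sub>i = card (blk -` {i})\<close>.
  The factor \<open>\<real>\<^bsup>n\<^sub>i\<^esup>\<close> is identified with the coordinate subspace of the vectors supported on
  block \<open>i\<close>, and \<open>x\<^sub>i\<close> with the projection of \<open>x\<close> onto it. Only the values of the \<open>i\<close>-th
  summand on that subspace matter.
\<close>
definition block_space :: "('n::finite \<Rightarrow> 'b::finite) \<Rightarrow> 'b \<Rightarrow> (real^'n) set" where
  "block_space blk i = {x. \<forall>j. blk j \<noteq> i \<longrightarrow> x $ j = 0}"

definition block_part :: "('n::finite \<Rightarrow> 'b::finite) \<Rightarrow> 'b \<Rightarrow> real^'n \<Rightarrow> real^'n" where
  "block_part blk i x = (\<chi> j. if blk j = i then x $ j else 0)"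

definition separable_sum ::
    "('n::finite \<Rightarrow> 'b::finite) \<Rightarrow> ('b \<Rightarrow> real^'n \<Rightarrow> ereal) \<Rightarrow> real^'n \<Rightarrow> ereal" where
  "separable_sum blk fs x = (\<Sum>i\<in>UNIV. fs i (block_part blk i x))"

section \<open>The problem of minimizing f subject to A x = b\<close>

definition solution_set :: "real^'n::finite^'m::finite \<Rightarrow> real^'m \<Rightarrow> (real^'n) set" where
  "solution_set A b = {x. A *v x = b}"

definition range_transpose :: "real^'n::finite^'m::finite \<Rightarrow> (real^'n) set" where
  "range_transpose A = range (\<lambda>y. transpose A *v y)"

definition infeasible ::
    "(real^'n::finite \<Rightarrow> ereal) \<Rightarrow> real^'n^'m::finite \<Rightarrow> real^'m \<Rightarrow> bool" where
  "infeasible f A b \<longleftrightarrow> effective_domain f \<inter> solution_set A b = {}"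

definition unbounded ::
    "(real^'n::finite \<Rightarrow> ereal) \<Rightarrow> real^'n^'m::finite \<Rightarrow> real^'m \<Rightarrow> bool" where
  "unbounded f A b \<longleftrightarrow> \<not> infeasible f A b \<and> (INF x\<in>solution_set A b. f x) = -\<infinity>"

text \<open>
  The library sets \<open>setdist S T = 0\<close> when one of the sets is empty. For a proper closed convex
  \<open>f\<close> and a consistent system \<open>A x = b\<close> none of the sets below is empty.
\<close>
definition primal_strongly_infeasible ::
    "(real^'n::finite \<Rightarrow> ereal) \<Rightarrow> real^'n^'m::finite \<Rightarrow> real^'m \<Rightarrow> bool" where
  "primal_strongly_infeasible f A b \<longleftrightarrow> setdist (effective_domain f) (solution_set A b) > 0"

definition dual_strongly_infeasible ::
    "(real^'n::finite \<Rightarrow> ereal) \<Rightarrow> real^'n^'m::finite \<Rightarrow> bool" where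
  "dual_strongly_infeasible f A \<longleftrightarrow>
     setdist (effective_domain (conjugate f)) (range_transpose A) > 0"

definition pathological ::
    "(real^'n::finite \<Rightarrow> ereal) \<Rightarrow> real^'n^'m::finite \<Rightarrow> real^'m \<Rightarrow> bool" where
  "pathological f A b \<longleftrightarrow> primal_strongly_infeasible f A b \<or> dual_strongly_infeasible f A"

text \<open>
  Infeasible, but with \<open>dom f\<close> and \<open>{x. A x = b}\<close> at distance zero. Such a problem can be dual
  strongly infeasible: take \<open>f (x, y) = -x\<close> on \<open>{x > 0, x y \<ge> 1}\<close> with the constraint \<open>y = 0\<close>.
  There the residuals \<open>A x\<^bsup>k+1/2\<^esup> - b\<close> tend to zero although the problem, being infeasible,
  is not unbounded. Unboundedness can therefore be claimed only outside this case.
\<close>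
definition primal_weakly_infeasible ::
    "(real^'n::finite \<Rightarrow> ereal) \<Rightarrow> real^'n^'m::finite \<Rightarrow> real^'m \<Rightarrow> bool" where
  "primal_weakly_infeasible f A b \<longleftrightarrow> infeasible f A b \<and> \<not> primal_strongly_infeasible f A b"

definition dual_feasible ::
    "(real^'n::finite \<Rightarrow> ereal) \<Rightarrow> real^'n^'m::finite \<Rightarrow> bool" where
  "dual_feasible f A \<longleftrightarrow> effective_domain (conjugate f) \<inter> range_transpose A \<noteq> {}"

section \<open>Douglas-Rachford mapping\<close>

definition prox :: "real \<Rightarrow> (real^'n::finite \<Rightarrow> ereal) \<Rightarrow> real^'n \<Rightarrow> real^'n" where
  "prox t f v = arg_min (\<lambda>x. f x + ereal (1 / (2 * t) * (norm (x - v))\<^sup>2)) (\<lambda>_. True)"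

text \<open>The Moore-Penrose inverse, as the unique solution of the four Penrose equations.\<close>
definition pseudoinverse :: "real^'n::finite^'m::finite \<Rightarrow> real^'m^'n" where
  "pseudoinverse A = (THE X. A ** X ** A = A \<and> X ** A ** X = X \<and>
     transpose (A ** X) = A ** X \<and> transpose (X ** A) = X ** A)"

definition affine_proj ::
    "real^'n::finite^'m::finite \<Rightarrow> real^'m \<Rightarrow> real^'n \<Rightarrow> real^'n" where
  "affine_proj A b v = v - pseudoinverse A *v (A *v v - b)"

definition F_DRS ::
    "(real^'n::finite \<Rightarrow> ereal) \<Rightarrow> real^'n^'m::finite \<Rightarrow> real^'m \<Rightarrow> real \<Rightarrow> real^'n \<Rightarrow> real^'n" where
  "F_DRS f A b t v = v + affine_proj A b (2 *\<^sub>R prox t f v - v) - prox t f v"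

section \<open>A2DR\<close>

text \<open>
  With memory \<open>M\<close> at iteration \<open>k\<close>, the matrices \<open>Y\<^sub>k\<close> and \<open>S\<^sub>k\<close> have the columns
  \<open>y\<^bsup>k-M+i\<^esup>\<close> and \<open>s\<^bsup>k-M+i\<^esup>\<close> for \<open>i < M\<close>. They are passed as \<open>i \<mapsto> column i\<close>, so the
  squared Frobenius norm is the sum of the squared column norms. Only the first \<open>M\<close> entries of
  \<open>\<gamma>\<close> are relevant.
\<close>
definition AA_objective ::
    "real \<Rightarrow> nat \<Rightarrow> 'a::euclidean_space \<Rightarrow> (nat \<Rightarrow> 'a) \<Rightarrow> (nat \<Rightarrow> 'a) \<Rightarrow> (nat \<Rightarrow> real) \<Rightarrow> real" where
  "AA_objective \<eta> M g Y S \<gamma> =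
     (norm (g - (\<Sum>i<M. \<gamma> i *\<^sub>R Y i)))\<^sup>2 +
     \<eta> * ((\<Sum>i<M. (norm (S i))\<^sup>2) + (\<Sum>i<M. (norm (Y i))\<^sup>2)) * (\<Sum>i<M. (\<gamma> i)\<^sup>2)"

definition AA_weight :: "nat \<Rightarrow> (nat \<Rightarrow> real) \<Rightarrow> nat \<Rightarrow> real" where
  "AA_weight M \<gamma> i =
     (if M = 0 then 1
      else if i = 0 then \<gamma> 0
      else if i < M then \<gamma> i - \<gamma> (i - 1)
      else 1 - \<gamma> (M - 1))"

text \<open>
  \<open>v\<close> is the sequence of iterates of a run started at \<open>v0\<close>. The values \<open>nAA k\<close>, \<open>RAA k\<close> and
  \<open>I k\<close> are those of the counters and the flag when iteration \<open>k \<ge> 1\<close> begins. When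
  \<open>S\<^sub>k = Y\<^sub>k = 0\<close> every \<open>\<gamma>\<close> is a minimizer, and a run may use any of them.
\<close>
definition a2dr_run ::
    "(real^'n::finite \<Rightarrow> ereal) \<Rightarrow> real^'n^'m::finite \<Rightarrow> real^'m \<Rightarrow> real^'n \<Rightarrow>
     real \<Rightarrow> real \<Rightarrow> real \<Rightarrow> real \<Rightarrow> nat \<Rightarrow> nat \<Rightarrow> (nat \<Rightarrow> real^'n) \<Rightarrow> bool" where
  "a2dr_run f A b v0 t \<eta> D \<epsilon> R Mmax v \<longleftrightarrow>
    (\<exists>(vDRS :: nat \<Rightarrow> real^'n) (vAA :: nat \<Rightarrow> real^'n) (g :: nat \<Rightarrow> real^'n)
      (\<gamma> :: nat \<Rightarrow> nat \<Rightarrow> real) (nAA :: nat \<Rightarrow> nat) (RAA :: nat \<Rightarrow> nat) (I :: nat \<Rightarrow> bool).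
      v 0 = v0 \<and> vDRS 1 = F_DRS f A b t (v 0) \<and> v 1 = vDRS 1 \<and> g 0 = v 0 - v 1 \<and>
      nAA 1 = 0 \<and> RAA 1 = 0 \<and> I 1 \<and>
      (\<forall>k\<ge>1.
        let M = min Mmax k;
            Y = (\<lambda>i. g (k - M + i + 1) - g (k - M + i));
            S = (\<lambda>i. v (k - M + i + 1) - v (k - M + i))
        in
          vDRS (k + 1) = F_DRS f A b t (v k) \<and>
          g k = v k - vDRS (k + 1) \<and>
          is_arg_min (AA_objective \<eta> M (g k) Y S) (\<lambda>_. True) (\<gamma> k) \<and>
          vAA (k + 1) = (\<Sum>j\<le>M. AA_weight M (\<gamma> k) j *\<^sub>R vDRS (k - M + j + 1)) \<and>
          (if I k \<or> R \<le> RAA k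
           then if norm (g k) \<le> D * norm (g 0) * (real (nAA k) / real R + 1) powr (- (1 + \<epsilon>))
                then v (k + 1) = vAA (k + 1) \<and> nAA (k + 1) = nAA k + 1 \<and>
                     RAA (k + 1) = 1 \<and> \<not> I (k + 1)
                else v (k + 1) = vDRS (k + 1) \<and> nAA (k + 1) = nAA k \<and>
                     RAA (k + 1) = 0 \<and> I (k + 1)
           else v (k + 1) = vAA (k + 1) \<and> nAA (k + 1) = nAA k + 1 \<and>
                RAA (k + 1) = RAA k + 1 \<and> \<not> I (k + 1))))"

end

theory Submission
  imports Defs "HOL-Real_Asymp.Real_Asymp"
begin

text \<open>
  Let \<open>N = A\<^sup>\<dagger> A\<close> be the orthogonal projector onto \<open>range A\<^sup>T\<close> and \<open>a = A\<^sup>\<dagger> b\<close>. With \<open>p = prox\<^bsub>t f\<^esub> v\<close> and the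
  subgradient \<open>u = (v - p) / t\<close> of \<open>f\<close> at \<open>p\<close>, the residual of the DRS map is the orthogonal sum
  \<open>v - F v = t (u - N u) + (N p - a)\<close>. The first part ranges over gaps between \<open>dom f\<^sup>*\<close> and
  \<open>range A\<^sup>T\<close>, the second over gaps between \<open>dom f\<close> and \<open>{x. A x = b}\<close>. Hence every residual is at
  least as long as \<open>w = t w\<^sub>2 + w\<^sub>1\<close>, where \<open>w\<^sub>1\<close> and \<open>w\<^sub>2\<close> are the shortest vectors in the closures
  of the two (convex) sets of gaps, and \<open>w \<noteq> 0\<close> precisely for pathological problems.

  Minimizing a penalized \<open>f\<close> gives residuals arbitrarily close to \<open>w\<close>. As \<open>F\<close> is firmly
  nonexpansive, the steps of any two of its orbits approach each other, so the step lengths of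
  each orbit tend to the infimum \<open>norm w\<close>, and by convexity the steps tend to \<open>w\<close>. Residuals
  bounded away from \<open>0\<close> fail the safeguard once the counter is large, so only finitely many AA
  steps occur and A2DR ends in an orbit of \<open>F\<close>.

  Since \<open>N (v - F v) = N p - a\<close>, the condition \<open>A x\<^bsup>k+1/2\<^esup> \<rightarrow> b\<close> means \<open>w\<^sub>1 = 0\<close>. When \<open>w\<^sub>2 \<noteq> 0\<close>,
  the direction \<open>- w\<^sub>2\<close> lies in the kernel of \<open>A\<close> and \<open>f\<close> decreases along it at a positive rate.
\<close>

section \<open>The pseudoinverse\<close>

lemma matrix_generalized_inverse:
  fixes B :: "real^'n::finite^'m::finite"
  shows "\<exists>G. B ** G ** B = B"
proof -
  obtain h where h: "linear h" "\<And>y. y \<in> range ((*v) B) \<Longrightarrow> B *v (h y) = y"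
    using linear_exists_right_inverse_on[of "(*v) B" UNIV] by auto
  have "B ** matrix h ** B = B"
    unfolding matrix_eq
    using h by (auto simp flip: matrix_vector_mul_assoc simp: matrix_works)
  then show ?thesis by blast
qed

text \<open>\<open>B ** X\<close> is to be the orthogonal projector onto the range of
  \<open>B\<close>. The normal equations suggest \<open>X = G ** transpose B\<close> with
  \<open>G\<close> a generalized inverse of \<open>transpose B ** B\<close>.\<close>

lemma matrix_least_squares_inverse:
  fixes B :: "real^'n::finite^'m::finite"
  shows "\<exists>X. B ** X ** B = B \<and> transpose (B ** X) = B ** X"
proof -
  let ?T = "transpose B"
  obtain G where G: "(?T ** B) ** G ** (?T ** B) = ?T ** B"
    using matrix_generalized_inverse by blast
  have PB: "B ** (G ** ?T) ** B = B"
    unfolding matrix_eq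
  proof
    fix x
    let ?z = "(G ** ?T ** B) *v x - x"
    have "?T *v (B *v ?z) = 0"
      using arg_cong[OF G, of "\<lambda>M. M *v x"]
      by (simp add: matrix_vector_mul_assoc matrix_mul_assoc matrix_vector_mult_diff_distrib)
    then have "(B *v ?z) \<bullet> (B *v ?z) = 0"
      by (metis dot_lmul_matrix inner_zero_left transpose_matrix_vector vector_transpose_matrix)
    then show "B ** (G ** ?T) ** B *v x = B *v x"
      by (simp add: matrix_vector_mul_assoc matrix_mul_assoc matrix_vector_mult_diff_distrib)
  qed
  let ?P = "B ** (G ** ?T)"
  \<comment> \<open>By \<open>PB\<close> the product collapses to \<open>transpose ?P\<close>, which
    is thereby symmetric.\<close>
  have "?P ** transpose ?P = transpose ?P"
    using PB by (simp add: matrix_transpose_mul matrix_mul_assoc)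
  then have "transpose ?P = ?P"
    by (metis matrix_transpose_mul transpose_transpose)
  with PB show ?thesis by blast
qed

text \<open>\<open>X2 ** A ** X1\<close> inherits the symmetry of \<open>A ** X1\<close> on one side
  and of \<open>X2 ** A\<close> on the other. Uniqueness makes the definite description in
  \<open>pseudoinverse\<close> meaningful.\<close>

lemma pseudoinverse_penrose:
  fixes A :: "real^'n::finite^'m::finite"
  defines "X \<equiv> pseudoinverse A"
  shows "A ** X ** A = A" "X ** A ** X = X"
    "transpose (A ** X) = A ** X" "transpose (X ** A) = X ** A"
proof -
  let ?Q = "\<lambda>X. A ** X ** A = A \<and> X ** A ** X = X \<and>
     transpose (A ** X) = A ** X \<and> transpose (X ** A) = X ** A"
  obtain X1 where X1: "A ** X1 ** A = A" "transpose (A ** X1) = A ** X1"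
    using matrix_least_squares_inverse by blast
  obtain Z where Z: "transpose A ** Z ** transpose A = transpose A"
    "transpose (transpose A ** Z) = transpose A ** Z"
    using matrix_least_squares_inverse by blast
  define X2 where "X2 = transpose Z"
  have X2: "A ** X2 ** A = A" "transpose (X2 ** A) = X2 ** A"
    using arg_cong[OF Z(1), of transpose] Z(2)
    by (simp_all add: X2_def matrix_transpose_mul matrix_mul_assoc)
  have absorb: "Z ** A ** X1 ** A = Z ** A" "Z ** A ** X2 ** A = Z ** A"
    for Z :: "real^'m^'k"
    using arg_cong[OF X1(1), of "\<lambda>M. Z ** M"] arg_cong[OF X2(1), of "\<lambda>M. Z ** M"]
    by (simp_all add: matrix_mul_assoc)
  have Q: "?Q (X2 ** A ** X1)"
    using X1 X2 by (simp add: matrix_mul_assoc absorb)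
  have unique: "Y = Y'" if Y: "?Q Y" and Y': "?Q Y'" for Y Y'
  proof -
    \<comment> \<open>The product of the two symmetric matrices reduces to one factor in this order
      and, after transposition, to the other.\<close>
    have "A ** Y = transpose ((A ** Y') ** (A ** Y))"
      using Y Y' by (simp add: matrix_mul_assoc)
    also have "\<dots> = (A ** Y) ** (A ** Y')"
      using Y Y' by (subst matrix_transpose_mul) simp
    also have "\<dots> = A ** Y'"
      using Y by (simp add: matrix_mul_assoc)
    finally have 1: "A ** Y = A ** Y'" .
    have "Y ** A = transpose ((Y ** A) ** (Y' ** A))"
      using Y Y' by (metis matrix_mul_assoc)
    also have "\<dots> = (Y' ** A) ** (Y ** A)"
      using Y Y' by (subst matrix_transpose_mul) simp
    also have "\<dots> = Y' ** A"
      using Y by (metis matrix_mul_assoc)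
    finally have 2: "Y ** A = Y' ** A" .
    have "Y = Y ** A ** Y"
      using Y by simp
    also have "\<dots> = Y' ** (A ** Y)"
      by (simp add: 2 matrix_mul_assoc)
    also have "\<dots> = Y' ** A ** Y'"
      by (simp add: 1 matrix_mul_assoc)
    finally show ?thesis
      using Y' by simp
  qed
  have "?Q (pseudoinverse A)"
    unfolding pseudoinverse_def using Q by (rule theI) (rule unique[OF _ Q])
  then show "A ** X ** A = A" "X ** A ** X = X"
    "transpose (A ** X) = A ** X" "transpose (X ** A) = X ** A"
    unfolding X_def by blast+
qed

section \<open>Epigraph of a separable sum\<close>

definition epigraph_on :: "'a set \<Rightarrow> ('a \<Rightarrow> ereal) \<Rightarrow> ('a \<times> real) set" where
  "epigraph_on V h = {(x, r). x \<in> V \<and> h x \<le> ereal r}"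

text \<open>Closedness of the epigraph is lower semicontinuity, and sums are easier to treat through
  the open sets \<open>{x. ereal c < h x}\<close>.\<close>

lemma closed_epigraph_iff:
  fixes h :: "'a::euclidean_space \<Rightarrow> ereal"
  shows "closed (epigraph_on UNIV h) \<longleftrightarrow> (\<forall>c. open {x. ereal c < h x})"
proof
  assume cl: "closed (epigraph_on UNIV h)"
  show "\<forall>c. open {x. ereal c < h x}"
  proof
    fix c
    have "closed ((\<lambda>x. (x, c)) -` epigraph_on UNIV h)"
      by (intro closed_vimage cl continuous_intros)
    moreover have "{x. ereal c < h x} = - ((\<lambda>x. (x, c)) -` epigraph_on UNIV h)"
      by (auto simp: epigraph_on_def)
    ultimately show "open {x. ereal c < h x}"
      by (simp add: open_Compl)
  qed
next
  assume *: "\<forall>c. open {x. ereal c < h x}"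
  have "- epigraph_on UNIV h = (\<Union>c. {x. ereal c < h x} \<times> {..<c})" (is "?L = ?R")
  proof (intro equalityI subsetI)
    fix z assume "z \<in> ?L"
    then obtain x r where z: "z = (x, r)" "ereal r < h x"
      by (cases z) (auto simp: epigraph_on_def)
    then obtain c where "ereal r < ereal c" "ereal c < h x"
      using ereal_dense2 by blast
    then show "z \<in> ?R" by (auto simp: z)
  next
    fix z assume "z \<in> ?R"
    then obtain x r c where "z = (x, r)" "ereal c < h x" "r < c"
      by auto
    then show "z \<in> ?L"
      by (auto simp: epigraph_on_def not_le intro: less_trans[of _ "ereal c"])
  qed
  moreover have "open ?R"
    using * by (intro open_UN ballI open_Times) auto
  ultimately show "closed (epigraph_on UNIV h)"
    by (simp add: closed_def)
qed

text \<open>A summand \<open>\<infinity>\<close> absorbs any deficit; between finite summands the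
  slack is halved.\<close>

lemma ereal_less_addE:
  fixes x y :: ereal
  assumes "ereal c < x + y" "x \<noteq> -\<infinity>" "y \<noteq> -\<infinity>"
  obtains a b where "ereal a < x" "ereal b < y" "c \<le> a + b"
proof -
  consider "x = \<infinity>" | "y = \<infinity>" | r s where "x = ereal r" "y = ereal s"
    using assms by (cases x; cases y) auto
  then show ?thesis
  proof cases
    case 1
    have "-\<infinity> < y"
      using assms(3) by simp
    then obtain b where "ereal b < y"
      using ereal_dense2 by blast
    then show ?thesis using that[of "c - b" b] 1 by simp
  next
    case 2
    have "-\<infinity> < x"
      using assms(2) by simp
    then obtain a where "ereal a < x"
      using ereal_dense2 by blast
    then show ?thesis using that[of a "c - a"] 2 by simp
  next
    case 3
    then show ?thesis
      using assms(1) that[of "r - (r + s - c) / 2" "s - (r + s - c) / 2"] by (simp add: field_simps)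
  qed
qed

lemma closed_epigraph_add:
  fixes h k :: "'a::euclidean_space \<Rightarrow> ereal"
  assumes "closed (epigraph_on UNIV h)" "closed (epigraph_on UNIV k)"
    and fin: "\<And>x. h x \<noteq> -\<infinity>" "\<And>x. k x \<noteq> -\<infinity>"
  shows "closed (epigraph_on UNIV (\<lambda>x. h x + k x))"
  unfolding closed_epigraph_iff
proof
  fix c
  have "{x. ereal c < h x + k x} =
      (\<Union>(a, b)\<in>{(a, b). c \<le> a + b}. {x. ereal a < h x} \<inter> {x. ereal b < k x})"
  proof (intro equalityI subsetI)
    fix x assume "x \<in> {x. ereal c < h x + k x}"
    then obtain a b where "ereal a < h x" "ereal b < k x" "c \<le> a + b"
      using ereal_less_addE[OF _ fin] by (metis mem_Collect_eq)
    then show "x \<in> (\<Union>(a, b)\<in>{(a, b). c \<le> a + b}. {x. ereal a < h x} \<inter> {x. ereal b < k x})"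
      by blast
  next
    fix x assume "x \<in> (\<Union>(a, b)\<in>{(a, b). c \<le> a + b}. {x. ereal a < h x} \<inter> {x. ereal b < k x})"
    then obtain a b where ab: "c \<le> a + b" "ereal a < h x" "ereal b < k x"
      by auto
    then have "ereal a + ereal b < h x + k x"
      by (intro ereal_add_strict_mono2)
    moreover have "ereal c \<le> ereal a + ereal b"
      using ab by simp
    ultimately show "x \<in> {x. ereal c < h x + k x}"
      using le_less_trans by blast
  qed
  then show "open {x. ereal c < h x + k x}"
    using assms(1,2)[unfolded closed_epigraph_iff] by (auto intro!: open_UN open_Int)
qed

lemma ereal_add_leE:
  fixes x y :: ereal
  assumes "x + y \<le> ereal r" "x \<noteq> -\<infinity>" "y \<noteq> -\<infinity>"
  obtains a b where "x \<le> ereal a" "y \<le> ereal b" "a + b = r"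
proof -
  obtain p q where "x = ereal p" "y = ereal q"
    using assms by (cases x; cases y) auto
  then show ?thesis
    using assms that[of p "r - p"] by auto
qed

lemma convex_epigraph_add:
  fixes h k :: "'a::euclidean_space \<Rightarrow> ereal"
  assumes conv: "convex (epigraph_on UNIV h)" "convex (epigraph_on UNIV k)"
    and fin: "\<And>x. h x \<noteq> -\<infinity>" "\<And>x. k x \<noteq> -\<infinity>"
  shows "convex (epigraph_on UNIV (\<lambda>x. h x + k x))"
proof (rule convexI)
  fix z w :: "'a \<times> real" and u v :: real
  assume zw: "z \<in> epigraph_on UNIV (\<lambda>x. h x + k x)" "w \<in> epigraph_on UNIV (\<lambda>x. h x + k x)"
    and uv: "0 \<le> u" "0 \<le> v" "u + v = 1"
  obtain x a b where z: "z = (x, a + b)" "(x, a) \<in> epigraph_on UNIV h" "(x, b) \<in> epigraph_on UNIV k"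
    using zw(1) ereal_add_leE fin unfolding epigraph_on_def by (cases z) (auto, blast)
  obtain y c d where w: "w = (y, c + d)" "(y, c) \<in> epigraph_on UNIV h" "(y, d) \<in> epigraph_on UNIV k"
    using zw(2) ereal_add_leE fin unfolding epigraph_on_def by (cases w) (auto, blast)
  have "h (u *\<^sub>R x + v *\<^sub>R y) \<le> ereal (u * a + v * c)"
    using convexD[OF conv(1) z(2) w(2) uv] by (simp add: epigraph_on_def)
  moreover have "k (u *\<^sub>R x + v *\<^sub>R y) \<le> ereal (u * b + v * d)"
    using convexD[OF conv(2) z(3) w(3) uv] by (simp add: epigraph_on_def)
  ultimately have "h (u *\<^sub>R x + v *\<^sub>R y) + k (u *\<^sub>R x + v *\<^sub>R y)
      \<le> ereal (u * a + v * c) + ereal (u * b + v * d)"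
    by (rule add_mono)
  also have "\<dots> = ereal (u * (a + b) + v * (c + d))"
    by (simp add: algebra_simps)
  finally show "u *\<^sub>R z + v *\<^sub>R w \<in> epigraph_on UNIV (\<lambda>x. h x + k x)"
    by (simp add: epigraph_on_def z w)
qed

text \<open>The exclusion of \<open>-\<infinity>\<close> is carried through the induction because
  adding the next summand needs it for the partial sum.\<close>

lemma closed_convex_epigraph_sum:
  fixes h :: "'b \<Rightarrow> 'a::euclidean_space \<Rightarrow> ereal"
  assumes "finite S"
    and "\<And>i. i \<in> S \<Longrightarrow> closed (epigraph_on UNIV (h i)) \<and> convex (epigraph_on UNIV (h i))"
    and "\<And>i x. i \<in> S \<Longrightarrow> h i x \<noteq> -\<infinity>"
  shows "closed (epigraph_on UNIV (\<lambda>x. \<Sum>i\<in>S. h i x)) \<and>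
    convex (epigraph_on UNIV (\<lambda>x. \<Sum>i\<in>S. h i x)) \<and> (\<forall>x. (\<Sum>i\<in>S. h i x) \<noteq> -\<infinity>)"
  using assms
proof (induction S)
  case empty
  have "epigraph_on (UNIV :: 'a set) (\<lambda>x. 0) = UNIV \<times> {0..}"
    by (auto simp: epigraph_on_def zero_ereal_def)
  then show ?case
    by (simp add: closed_Times convex_Times)
next
  case (insert j S)
  then have IH: "closed (epigraph_on UNIV (\<lambda>x. \<Sum>i\<in>S. h i x))"
    "convex (epigraph_on UNIV (\<lambda>x. \<Sum>i\<in>S. h i x))" "\<And>x. (\<Sum>i\<in>S. h i x) \<noteq> -\<infinity>"
    and j: "closed (epigraph_on UNIV (h j))" "convex (epigraph_on UNIV (h j))" "\<And>x. h j x \<noteq> -\<infinity>"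
    by auto
  show ?case
    using closed_epigraph_add[OF j(1) IH(1) j(3) IH(3)] convex_epigraph_add[OF j(2) IH(2) j(3) IH(3)]
      IH(3) j(3) insert.hyps by simp
qed

lemma linear_block_part: "linear (block_part blk i)"
  by (rule linearI) (auto simp: block_part_def vec_eq_iff)

text \<open>Composing a summand with its linear block projection gives an epigraph that is a linear
  preimage of the given one. Properness holds since points of finite value in the blocks can be
  glued together.\<close>

lemma closed_convex_proper_separable_sum:
  fixes blk :: "'n::finite \<Rightarrow> 'b::finite"
  assumes fs: "\<And>i. closed_convex_proper_on (block_space blk i) (fs i)"
  shows "closed_convex_proper_on UNIV (separable_sum blk fs)"
proof -
  define h where "h i x = fs i (block_part blk i x)" for i x
  have sum: "separable_sum blk fs = (\<lambda>x. \<Sum>i\<in>UNIV. h i x)"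
    by (simp add: separable_sum_def h_def fun_eq_iff)
  have bp: "block_part blk i x \<in> block_space blk i" for i x
    by (auto simp: block_part_def block_space_def)
  have fin: "h i x \<noteq> -\<infinity>" for i x
    using fs[of i] bp[of i x] by (simp add: h_def closed_convex_proper_on_def)
  have epi: "closed (epigraph_on UNIV (h i)) \<and> convex (epigraph_on UNIV (h i))" for i
  proof -
    let ?g = "\<lambda>z. (block_part blk i (fst z), snd z :: real)"
    have E: "epigraph_on UNIV (h i) = ?g -` {(x, r). x \<in> block_space blk i \<and> fs i x \<le> ereal r}"
      using bp by (auto simp: epigraph_on_def h_def)
    have lin: "linear ?g"
      using linear_block_part[of blk i] by (auto intro!: linearI simp: linear_add linear_scale)
    then have "continuous_on UNIV ?g"
      by (simp add: linear_continuous_on linear_conv_bounded_linear)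
    moreover have "closed {(x, r::real). x \<in> block_space blk i \<and> fs i x \<le> ereal r}"
      "convex {(x, r::real). x \<in> block_space blk i \<and> fs i x \<le> ereal r}"
      using fs[of i] by (simp_all add: closed_convex_proper_on_def)
    ultimately show ?thesis
      unfolding E using lin by (intro conjI closed_vimage convex_linear_vimage)
  qed
  have "\<forall>i. \<exists>z. z \<in> block_space blk i \<and> fs i z < \<infinity>"
    using fs unfolding closed_convex_proper_on_def by blast
  then obtain z where z: "\<And>i. z i \<in> block_space blk i" "\<And>i. fs i (z i) < \<infinity>"
    by metis
  have "block_part blk i (\<chi> j. z (blk j) $ j) = z i" for i
    using z(1)[of i] by (auto simp: block_part_def block_space_def vec_eq_iff)
  then have "separable_sum blk fs (\<chi> j. z (blk j) $ j) = (\<Sum>i\<in>UNIV. fs i (z i))"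
    by (simp add: separable_sum_def)
  also have "\<dots> \<noteq> \<infinity>"
    using z(2) by (auto simp: sum_Pinfty)
  finally have "separable_sum blk fs (\<chi> j. z (blk j) $ j) < \<infinity>"
    by simp
  then show ?thesis
    using closed_convex_epigraph_sum[of UNIV h, OF _ epi fin]
    unfolding closed_convex_proper_on_def sum epigraph_on_def by auto
qed

section \<open>Subgradients and the proximal minimization\<close>

text \<open>The function is represented by its epigraph \<open>E\<close>, so that the estimates use
  real heights. \<open>proper\<close> provides a point at which the value is finite.\<close>

locale closed_convex_epigraph =
  fixes E :: "('a::euclidean_space \<times> real) set"
  assumes closed_E: "closed E"
    and convex_E: "convex E"
    and upward: "(x, r) \<in> E \<Longrightarrow> r \<le> s \<Longrightarrow> (x, s) \<in> E"
    and proper: "\<exists>x r s. (x, r) \<in> E \<and> (x, s) \<notin> E"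
begin

definition effdom :: "'a set" where "effdom = fst ` E"

text \<open>The domain of the conjugate: \<open>M\<close> bounds the supremum that defines
  it.\<close>

definition conjugate_dom :: "'a set" where
  "conjugate_dom = {u. \<exists>M. \<forall>(x, r)\<in>E. u \<bullet> x - r \<le> M}"

text \<open>The choice \<open>y = p\<close> shows that \<open>\<rho>\<close> is the value of the
  function at \<open>p\<close>.\<close>

definition subgradient :: "'a \<Rightarrow> 'a \<Rightarrow> bool" where
  "subgradient p u \<longleftrightarrow> (\<exists>\<rho>. (p, \<rho>) \<in> E \<and> (\<forall>(y, s)\<in>E. s \<ge> \<rho> + u \<bullet> (y - p)))"

lemma convex_effdom: "convex effdom"
  unfolding effdom_def by (intro convex_linear_image convex_E linear_fst)

lemma effdom_nonempty: "effdom \<noteq> {}"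
  using proper unfolding effdom_def by blast

lemma convex_conjugate_dom: "convex conjugate_dom"
proof (rule convexI)
  fix u w :: 'a and \<alpha> \<beta> :: real
  assume "u \<in> conjugate_dom" "w \<in> conjugate_dom" and c: "0 \<le> \<alpha>" "0 \<le> \<beta>" "\<alpha> + \<beta> = 1"
  then obtain M K where M: "\<And>x r. (x, r) \<in> E \<Longrightarrow> u \<bullet> x - r \<le> M"
    and K: "\<And>x r. (x, r) \<in> E \<Longrightarrow> w \<bullet> x - r \<le> K"
    unfolding conjugate_dom_def by blast
  have "(\<alpha> *\<^sub>R u + \<beta> *\<^sub>R w) \<bullet> x - r \<le> \<alpha> * M + \<beta> * K" if "(x, r) \<in> E" for x r
  proof -
    have "(\<alpha> *\<^sub>R u + \<beta> *\<^sub>R w) \<bullet> x - r = \<alpha> * (u \<bullet> x) + \<beta> * (w \<bullet> x) - (\<alpha> + \<beta>) * r"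
      using c by (simp add: inner_add_left)
    also have "\<dots> = \<alpha> * (u \<bullet> x - r) + \<beta> * (w \<bullet> x - r)"
      by (simp add: algebra_simps)
    also have "\<dots> \<le> \<alpha> * M + \<beta> * K"
      using M[OF that] K[OF that] c by (intro add_mono mult_left_mono) auto
    finally show ?thesis .
  qed
  then show "\<alpha> *\<^sub>R u + \<beta> *\<^sub>R w \<in> conjugate_dom"
    unfolding conjugate_dom_def by blast
qed

lemma subgradient_effdom: "subgradient p u \<Longrightarrow> p \<in> effdom"
  unfolding subgradient_def effdom_def by force

lemma subgradient_conjugate_dom:
  assumes "subgradient p u" shows "u \<in> conjugate_dom"
proof -
  obtain \<rho> where "\<And>y s. (y, s) \<in> E \<Longrightarrow> s \<ge> \<rho> + u \<bullet> (y - p)"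
    using assms unfolding subgradient_def by blast
  then have "\<forall>(y, s)\<in>E. u \<bullet> y - s \<le> u \<bullet> p - \<rho>"
    by (fastforce simp: inner_diff_right)
  then show ?thesis
    unfolding conjugate_dom_def by blast
qed

lemma subgradient_monotone:
  assumes "subgradient p u" "subgradient q w"
  shows "0 \<le> (u - w) \<bullet> (p - q)"
proof -
  obtain \<rho> where "(p, \<rho>) \<in> E" "\<And>y s. (y, s) \<in> E \<Longrightarrow> s \<ge> \<rho> + u \<bullet> (y - p)"
    using assms(1) unfolding subgradient_def by blast
  moreover obtain \<sigma> where "(q, \<sigma>) \<in> E" "\<And>y s. (y, s) \<in> E \<Longrightarrow> s \<ge> \<sigma> + w \<bullet> (y - q)"
    using assms(2) unfolding subgradient_def by blast
  ultimately have "\<sigma> \<ge> \<rho> + u \<bullet> (q - p)" "\<rho> \<ge> \<sigma> + w \<bullet> (p - q)"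
    by blast+
  then show ?thesis
    by (simp add: inner_diff_left inner_diff_right)
qed

text \<open>A hyperplane separating \<open>E\<close> from a point below it is not vertical, so it
  yields an affine minorant, whose slope lies in \<open>conjugate_dom\<close>.\<close>

lemma conjugate_dom_nonempty: "conjugate_dom \<noteq> {}"
proof -
  obtain x0 r0 s0 where x0: "(x0, r0) \<in> E" "(x0, s0) \<notin> E"
    using proper by blast
  obtain a c where sep: "a \<bullet> (x0, s0) < c" "\<And>z. z \<in> E \<Longrightarrow> a \<bullet> z > c"
    using separating_hyperplane_closed_point[OF convex_E closed_E x0(2)] by blast
  obtain a1 \<beta> where a: "a = (a1, \<beta>)"
    by (cases a)
  have "s0 < r0"
    using x0 upward by (meson not_le)
  moreover have "\<beta> * s0 < \<beta> * r0"
    using sep(1) sep(2)[OF x0(1)] by (simp add: a)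
  ultimately have \<beta>: "\<beta> > 0"
    by (simp add: mult_less_cancel_left)
  have "(- (a1 /\<^sub>R \<beta>)) \<bullet> x - r \<le> - c / \<beta>" if "(x, r) \<in> E" for x r
  proof -
    have "inverse \<beta> * c \<le> inverse \<beta> * (a1 \<bullet> x + \<beta> * r)"
      using sep(2)[OF that] \<beta> by (intro mult_left_mono) (auto simp: a)
    also have "\<dots> = inverse \<beta> * (a1 \<bullet> x) + r"
      using \<beta> by (simp add: distrib_left)
    finally show ?thesis
      by (simp add: divide_inverse mult.commute)
  qed
  then have "- (a1 /\<^sub>R \<beta>) \<in> conjugate_dom"
    unfolding conjugate_dom_def by blast
  then show ?thesis by blast
qed

text \<open>By an affine minorant of \<open>E\<close> the height can fall only linearly, while
  \<open>q\<close> grows quadratically. Hence a sublevel set of their sum is compact.\<close>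

lemma minimizer_exists:
  fixes q :: "'a \<Rightarrow> real"
  assumes cont: "continuous_on UNIV q" and \<kappa>: "\<kappa> > 0"
    and growth: "\<And>x. q x \<ge> \<kappa> * (norm x)\<^sup>2 + l \<bullet> x - C"
  obtains p \<rho> where "(p, \<rho>) \<in> E" "\<And>y s. (y, s) \<in> E \<Longrightarrow> \<rho> + q p \<le> s + q y"
proof -
  obtain x0 r0 where x0: "(x0, r0) \<in> E"
    using proper by blast
  obtain u M where u: "\<And>x r. (x, r) \<in> E \<Longrightarrow> u \<bullet> x - r \<le> M"
    using conjugate_dom_nonempty unfolding conjugate_dom_def by blast
  define h where "h = (\<lambda>(x, r). r + q x)"
  define S where "S = {z \<in> E. h z \<le> r0 + q x0}"
  have cont_h: "continuous_on UNIV h"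
    unfolding h_def case_prod_beta
    by (intro continuous_intros continuous_on_compose2[OF cont]) auto
  have "closed S"
    unfolding S_def using closed_Collect_le[OF cont_h continuous_on_const]
    by (simp add: Collect_conj_eq closed_E closed_Int)
  \<comment> \<open>\<open>B\<close> collects the slopes of the linear terms and \<open>K\<close>
    the constants; beyond the radius \<open>(B + K) / \<kappa> + 1\<close> the quadratic term
    exceeds \<open>B * norm x + K\<close>.\<close>
  define B where "B = norm (u + l)"
  define K where "K = \<bar>C + M + r0 + q x0\<bar>"
  have sub: "norm x \<le> (B + K) / \<kappa> + 1" if "(x, r) \<in> S" for x r
  proof (rule ccontr)
    assume "\<not> ?thesis"
    then have n: "norm x > 1 + (B + K) / \<kappa>" by simp
    have BK: "B \<ge> 0" "K \<ge> 0" by (auto simp: B_def K_def)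
    then have n1: "norm x \<ge> 1"
      using n \<kappa> by (smt (verit) divide_nonneg_pos)
    have "B + K < \<kappa> * (norm x - 1)"
      using n \<kappa> by (simp add: field_simps)
    then have "B + K < \<kappa> * norm x"
      using \<kappa> by (simp add: algebra_simps)
    then have "(B + K) * norm x < \<kappa> * norm x * norm x"
      using n1 by (intro mult_strict_right_mono) auto
    moreover have "K \<le> K * norm x"
      using n1 BK by (simp add: mult_le_cancel_left1)
    ultimately have "K < \<kappa> * (norm x)\<^sup>2 - B * norm x"
      by (simp add: algebra_simps power2_eq_square)
    moreover have "r + q x \<le> r0 + q x0" "u \<bullet> x - r \<le> M"
      using that u by (auto simp: S_def h_def)
    moreover have "- B * norm x \<le> (u + l) \<bullet> x"
      unfolding B_def using Cauchy_Schwarz_ineq2[of "u + l" x] by simp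
    ultimately show False
      using growth[of x] by (simp add: K_def inner_add_left)
  qed
  define X where "X = (B + K) / \<kappa> + 1"
  have "S \<subseteq> cball 0 X \<times> {- norm u * X - M .. r0 + q x0 + norm l * X + C}"
  proof clarsimp
    fix x r assume S: "(x, r) \<in> S"
    have nx: "norm x \<le> X"
      using sub[OF S] by (simp add: X_def)
    have "r + q x \<le> r0 + q x0" "u \<bullet> x - r \<le> M"
      using S u by (auto simp: S_def h_def)
    moreover have "- (norm u * X) \<le> u \<bullet> x" "- (norm l * X) \<le> l \<bullet> x"
      using Cauchy_Schwarz_ineq2[of u x] Cauchy_Schwarz_ineq2[of l x]
        mult_left_mono[OF nx norm_ge_zero[of u]] mult_left_mono[OF nx norm_ge_zero[of l]]
      by linarith+
    moreover have "0 \<le> \<kappa> * (norm x)\<^sup>2"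
      using \<kappa> by simp
    ultimately show "norm x \<le> X \<and> - (norm u * X) - M \<le> r \<and> r \<le> r0 + q x0 + norm l * X + C"
      using growth[of x] nx by linarith
  qed
  then have "bounded S"
    by (rule bounded_subset[rotated]) (intro bounded_Times bounded_cball bounded_closed_interval)
  with \<open>closed S\<close> have "compact S"
    by (simp add: compact_eq_bounded_closed)
  moreover have S0: "(x0, r0) \<in> S"
    by (simp add: S_def x0 h_def)
  ultimately obtain z where z: "z \<in> S" "\<And>w. w \<in> S \<Longrightarrow> h z \<le> h w"
    using continuous_attains_inf[of S h] continuous_on_subset[OF cont_h] by blast
  obtain p \<rho> where p: "z = (p, \<rho>)" by (cases z)
  show ?thesis
  proof (rule that)
    show "(p, \<rho>) \<in> E" using z p by (simp add: S_def)
    show "\<rho> + q p \<le> s + q y" if "(y, s) \<in> E" for y s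
    proof (cases "(y, s) \<in> S")
      case True then show ?thesis using z(2)[OF True] by (simp add: p h_def)
    next
      case False
      then have "s + q y > r0 + q x0" using that by (auto simp: S_def h_def)
      then show ?thesis using z(2)[OF S0] by (simp add: p h_def)
    qed
  qed
qed

text \<open>A step \<open>\<tau>\<close> towards \<open>(y, s)\<close> stays in \<open>E\<close> by
  convexity and changes the objective by at most \<open>\<tau> * c + \<tau>\<^sup>2 * d\<close>.
  Minimality makes this nonnegative; division by \<open>\<tau>\<close> and the limit at
  \<open>0\<close> leave \<open>c \<ge> 0\<close>.\<close>

lemma minimizer_optimality:
  fixes q :: "'a \<Rightarrow> real"
  assumes p: "(p, \<rho>) \<in> E" and min: "\<And>y s. (y, s) \<in> E \<Longrightarrow> \<rho> + q p \<le> s + q y"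
    and smooth: "\<And>y. q y \<le> q p + g \<bullet> (y - p) + K * (norm (y - p))\<^sup>2"
    and y: "(y, s) \<in> E"
  shows "s \<ge> \<rho> + (- g) \<bullet> (y - p)"
proof -
  define c where "c = s - \<rho> + g \<bullet> (y - p)"
  define d where "d = K * (norm (y - p))\<^sup>2"
  have "0 \<le> c + \<tau> * d" if \<tau>: "0 < \<tau>" "\<tau> \<le> 1" for \<tau>
  proof -
    have "(1 - \<tau>) *\<^sub>R (p, \<rho>) + \<tau> *\<^sub>R (y, s) \<in> E"
      using convexD[OF convex_E p y, of "1 - \<tau>" \<tau>] \<tau> by simp
    moreover have "(1 - \<tau>) *\<^sub>R (p, \<rho>) + \<tau> *\<^sub>R (y, s) = (p + \<tau> *\<^sub>R (y - p), \<rho> + \<tau> * (s - \<rho>))"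
      by (simp add: algebra_simps)
    ultimately have "\<rho> + q p \<le> \<rho> + \<tau> * (s - \<rho>) + q (p + \<tau> *\<^sub>R (y - p))"
      using min by metis
    also have "\<dots> \<le> \<rho> + \<tau> * (s - \<rho>) + (q p + \<tau> * (g \<bullet> (y - p)) + \<tau>\<^sup>2 * d)"
      using smooth[of "p + \<tau> *\<^sub>R (y - p)"] by (simp add: d_def power_mult_distrib mult.left_commute)
    finally have "0 \<le> \<tau> * (c + \<tau> * d)"
      by (simp add: c_def algebra_simps power2_eq_square)
    then show ?thesis
      using \<tau> by (simp add: zero_le_mult_iff)
  qed
  moreover have "\<forall>\<^sub>F \<tau> in at_right 0. 0 < \<tau> \<and> \<tau> \<le> (1::real)"
    unfolding eventually_at_right_field by (intro exI[of _ 1]) auto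
  ultimately have ev: "\<forall>\<^sub>F \<tau> in at_right 0. 0 \<le> c + \<tau> * d"
    by (auto elim: eventually_mono)
  have "((\<lambda>\<tau>. c + \<tau> * d) \<longlongrightarrow> c + 0 * d) (at_right 0)"
    by (intro tendsto_intros)
  then have "0 \<le> c"
    using tendsto_lowerbound[OF _ ev] by simp
  then show ?thesis by (simp add: c_def)
qed

text \<open>The proximal term is quadratic with gradient \<open>(p - v) /\<^sub>R t\<close> at
  \<open>p\<close>.\<close>

lemma proximal_subgradient:
  assumes t: "t > 0" and p: "(p, \<rho>) \<in> E"
    and min: "\<And>y s. (y, s) \<in> E \<Longrightarrow>
      \<rho> + 1 / (2 * t) * (norm (p - v))\<^sup>2 \<le> s + 1 / (2 * t) * (norm (y - v))\<^sup>2"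
    and y: "(y, s) \<in> E"
  shows "s \<ge> \<rho> + ((v - p) /\<^sub>R t) \<bullet> (y - p)"
proof -
  let ?q = "\<lambda>y. 1 / (2 * t) * (norm (y - v))\<^sup>2"
  have "?q y \<le> ?q p + ((p - v) /\<^sub>R t) \<bullet> (y - p) + 1 / (2 * t) * (norm (y - p))\<^sup>2" for y
  proof -
    have "(norm (y - v))\<^sup>2 = (norm (p - v))\<^sup>2 + 2 * ((p - v) \<bullet> (y - p)) + (norm (y - p))\<^sup>2"
      unfolding power2_norm_eq_inner by (simp add: algebra_simps inner_commute)
    moreover have "((p - v) /\<^sub>R t) \<bullet> (y - p) = ((p - v) \<bullet> (y - p)) / t"
      by (simp add: divide_inverse mult.commute)
    ultimately show ?thesis
      using t by (simp only:) (simp add: field_simps)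
  qed
  from minimizer_optimality[OF p min this y] show ?thesis
    by (simp flip: scaleR_minus_right)
qed

lemma proximal_minimizer_exists:
  assumes t: "t > 0"
  obtains p \<rho> where "(p, \<rho>) \<in> E" "\<And>y s. (y, s) \<in> E \<Longrightarrow>
      \<rho> + 1 / (2 * t) * (norm (p - v))\<^sup>2 \<le> s + 1 / (2 * t) * (norm (y - v))\<^sup>2"
proof (rule minimizer_exists[of "\<lambda>y. 1 / (2 * t) * (norm (y - v))\<^sup>2" "1 / (2 * t)" "- (v /\<^sub>R t)" 0])
  show "1 / (2 * t) * (norm x)\<^sup>2 + - (v /\<^sub>R t) \<bullet> x - 0 \<le> 1 / (2 * t) * (norm (x - v))\<^sup>2" for x
  proof -
    have *: "(norm (x - v))\<^sup>2 = (norm x)\<^sup>2 - 2 * (v \<bullet> x) + (norm v)\<^sup>2"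
      unfolding power2_norm_eq_inner by (simp add: algebra_simps inner_commute)
    show ?thesis
      unfolding * using t by (simp add: field_simps)
  qed
qed (use t in \<open>auto intro!: continuous_intros\<close>)

text \<open>The proximal points of \<open>x + s *\<^sub>R d\<close> converge to \<open>x + s *\<^sub>R d\<close> as the proximal parameter
  \<open>\<lambda>\<close> tends to \<open>0\<close>, and the subgradient inequality at them already has the slope \<open>- \<sigma>\<close>.\<close>
lemma recession_direction:
  assumes d: "\<And>u. u \<in> conjugate_dom \<Longrightarrow> u \<bullet> d \<le> - \<sigma>"
    and x: "(x, r) \<in> E" and s: "s \<ge> 0"
  shows "(x + s *\<^sub>R d, r - s * \<sigma>) \<in> E"
proof -
  define z where "z = x + s *\<^sub>R d"
  obtain u0 M where u0: "\<And>x r. (x, r) \<in> E \<Longrightarrow> u0 \<bullet> x - r \<le> M"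
    using conjugate_dom_nonempty unfolding conjugate_dom_def by blast
  \<comment> \<open>\<open>C\<close> is the height of the target above the affine minorant
    \<open>u0 \<bullet> z - M\<close>, truncated at \<open>0\<close>.\<close>
  define C where "C = max 0 (r - s * \<sigma> + M - u0 \<bullet> z)"
  have near: "\<exists>p. (p, r - s * \<sigma>) \<in> E \<and> (norm (z - p))\<^sup>2 \<le> l * (C + norm u0 * norm (z - p))"
    if l: "l > 0" for l
  proof -
    obtain p \<rho> where p: "(p, \<rho>) \<in> E" and min: "\<And>y s. (y, s) \<in> E \<Longrightarrow>
        \<rho> + 1 / (2 * l) * (norm (p - z))\<^sup>2 \<le> s + 1 / (2 * l) * (norm (y - z))\<^sup>2"
      using proximal_minimizer_exists[OF l] by blast
    define u where "u = (z - p) /\<^sub>R l"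
    have sub: "s \<ge> \<rho> + u \<bullet> (y - p)" if "(y, s) \<in> E" for y s
      unfolding u_def by (rule proximal_subgradient[OF l p min that])
    then have "u \<in> conjugate_dom"
      using p subgradient_conjugate_dom unfolding subgradient_def by blast
    then have "s * (u \<bullet> d) \<le> s * (- \<sigma>)"
      using s d by (intro mult_left_mono) auto
    moreover have "r \<ge> \<rho> + u \<bullet> (z - p) - s * (u \<bullet> d)"
      using sub[OF x] by (simp add: z_def algebra_simps)
    moreover have "u \<bullet> (z - p) = (norm (z - p))\<^sup>2 / l"
      by (simp add: u_def power2_norm_eq_inner divide_inverse mult.commute)
    ultimately have *: "\<rho> + (norm (z - p))\<^sup>2 / l \<le> r - s * \<sigma>"
      by simp
    have "(norm (z - p))\<^sup>2 / l \<ge> 0"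
      using l by simp
    with * have "(p, r - s * \<sigma>) \<in> E"
      using upward[OF p] by simp
    \<comment> \<open>The minorant keeps \<open>\<rho>\<close> from being very low, which turns
      \<open>*\<close> into a bound on the distance of \<open>p\<close> from
      \<open>z\<close>.\<close>
    moreover have "u0 \<bullet> z - norm u0 * norm (z - p) \<le> u0 \<bullet> p"
      using norm_cauchy_schwarz[of u0 "z - p"] by (simp add: inner_diff_right)
    then have "(norm (z - p))\<^sup>2 / l \<le> C + norm u0 * norm (z - p)"
      using u0[OF p] * unfolding C_def by linarith
    then have "(norm (z - p))\<^sup>2 \<le> l * (C + norm u0 * norm (z - p))"
      using l by (simp add: field_simps)
    ultimately show ?thesis by blast
  qed
  have "(z, r - s * \<sigma>) \<in> closure E"
    unfolding closure_approachable
  proof (intro allI impI)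
    fix e :: real assume e: "e > 0"
    define X where "X = C + norm u0 * e + 1"
    \<comment> \<open>This makes \<open>l * X = e\<^sup>2 / 2\<close>, half of what a distance of at
      least \<open>e\<close> would require.\<close>
    define l where "l = e\<^sup>2 / (2 * X)"
    have C: "C \<ge> 0" by (simp add: C_def)
    have den: "X > 0"
      using C e by (simp add: X_def add_nonneg_pos)
    then have l: "l > 0" using e by (simp add: l_def)
    obtain p where p: "(p, r - s * \<sigma>) \<in> E"
      and n: "(norm (z - p))\<^sup>2 \<le> l * (C + norm u0 * norm (z - p))"
      using near[OF l] by blast
    have "norm (z - p) < e"
    proof (rule ccontr)
      define \<nu> where "\<nu> = norm (z - p)"
      assume "\<not> ?thesis"
      then have \<nu>: "\<nu> \<ge> e" by (simp add: \<nu>_def)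
      \<comment> \<open>Multiplication by \<open>e\<close> and \<open>e \<le> \<nu>\<close> make the
        right side a multiple of \<open>\<nu>\<close>, which then cancels.\<close>
      have "e * \<nu>\<^sup>2 \<le> l * (C * e + norm u0 * e * \<nu>)"
        using mult_left_mono[OF n, of e] e by (simp add: \<nu>_def algebra_simps)
      also have "\<dots> \<le> l * (C * \<nu> + norm u0 * e * \<nu>)"
        using l C \<nu> by (intro mult_left_mono add_right_mono) auto
      also have "\<dots> = l * (C + norm u0 * e) * \<nu>"
        by (simp add: algebra_simps)
      finally have "e * \<nu> \<le> l * (C + norm u0 * e)"
        using \<nu> e by (simp add: power2_eq_square flip: mult.assoc)
      also have "\<dots> \<le> l * X"
        using l by (intro mult_left_mono) (auto simp: X_def)
      also have "\<dots> = e\<^sup>2 / 2"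
        using den by (simp add: l_def)
      finally have "e * \<nu> \<le> e * (e / 2)" by (simp add: power2_eq_square)
      then show False using e \<nu> by simp
    qed
    then show "\<exists>y\<in>E. dist y (z, r - s * \<sigma>) < e"
      using p by (intro bexI[OF _ p]) (simp add: dist_Pair_Pair dist_norm norm_minus_commute)
  qed
  then show ?thesis
    using closed_E by (simp add: z_def closure_closed)
qed

end

section \<open>Orthogonal projectors\<close>

locale orthogonal_projector =
  fixes N :: "'a::euclidean_space \<Rightarrow> 'a"
  assumes linear_N: "linear N"
    and idem: "N (N x) = N x"
    and self_adjoint: "N x \<bullet> y = x \<bullet> N y"
begin

lemma N_simps:
  "N (x + y) = N x + N y" "N (x - y) = N x - N y" "N (c *\<^sub>R x) = c *\<^sub>R N x" "N 0 = 0"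
  using linear_N by (simp_all add: linear_add linear_diff linear_scale linear_0)

lemma norm_N_le: "norm (N x) \<le> norm x"
proof -
  have "(norm (N x))\<^sup>2 = N x \<bullet> x"
    unfolding power2_norm_eq_inner by (metis idem self_adjoint)
  also have "\<dots> \<le> norm (N x) * norm x"
    by (rule norm_cauchy_schwarz)
  finally show ?thesis
    by (cases "norm (N x) = 0") (auto simp: power2_eq_square)
qed

lemma norm_complement_le: "norm (x - N x) \<le> norm x"
proof -
  interpret compl: orthogonal_projector "\<lambda>x. x - N x"
    by unfold_locales
      (auto simp: N_simps idem self_adjoint inner_diff_left inner_diff_right algebra_simps
        intro!: linearI)
  show ?thesis by (rule compl.norm_N_le)
qed

lemma orthogonal_parts: "N x \<bullet> (y - N y) = 0"
  by (metis N_simps(2) cancel_comm_monoid_add_class.diff_cancel idem inner_zero_right self_adjoint)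

lemma continuous_N: "continuous_on S N"
  by (intro linear_continuous_on linear_conv_bounded_linear[THEN iffD1] linear_N)

end

section \<open>One subgradient pair close to two prescribed gaps\<close>

locale epigraph_with_projector = closed_convex_epigraph E + orthogonal_projector N
  for E :: "('a::euclidean_space \<times> real) set" and N :: "'a \<Rightarrow> 'a"
begin

text \<open>A small penalty \<open>\<epsilon>\<close> on the norm makes the penalized minimum attained. Comparing the minimum with
  the value at \<open>x0\<close> bounds both errors by a multiple of \<open>sqrt \<epsilon>\<close>.\<close>
lemma subgradient_approximation:
  assumes x0: "x0 \<in> effdom" and u0: "u0 \<in> conjugate_dom" and e: "e > 0"
  obtains p u where "subgradient p u" "norm (N p - N x0) < e"
    "norm ((u - N u) - (u0 - N u0)) < e"
proof -
  obtain r0 where r0: "(x0, r0) \<in> E"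
    using x0 unfolding effdom_def by force
  obtain M where M: "\<And>x r. (x, r) \<in> E \<Longrightarrow> u0 \<bullet> x - r \<le> M"
    using u0 unfolding conjugate_dom_def by blast
  define w where "w = u0 - N u0"
  define B where "B = norm u0"
  define C where "C = \<bar>r0 - w \<bullet> x0 + (norm x0)\<^sup>2 + M - u0 \<bullet> N x0\<bar>"
  define Q where "Q = 2 * C + B\<^sup>2"
  \<comment> \<open>\<open>\<epsilon>\<close> is taken so small that the error bound obtained at the
    end is below \<open>e\<close>.\<close>
  have "((\<lambda>\<epsilon>. \<epsilon> * B + sqrt (\<epsilon> * Q)) \<longlongrightarrow> 0 * B + sqrt (0 * Q)) (at_right 0)"
    by (intro tendsto_intros)
  then have "\<forall>\<^sub>F \<epsilon> in at_right 0. \<epsilon> * B + sqrt (\<epsilon> * Q) < e"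
    using e by (auto intro: order_tendstoD)
  moreover have "\<forall>\<^sub>F \<epsilon> in at_right 0. 0 < \<epsilon> \<and> \<epsilon> \<le> (1::real)"
    unfolding eventually_at_right_field by (intro exI[of _ 1]) auto
  ultimately obtain \<epsilon> where \<epsilon>: "0 < \<epsilon>" "\<epsilon> \<le> 1" "\<epsilon> * B + sqrt (\<epsilon> * Q) < e"
    using eventually_happens[OF eventually_conj] by force
  \<comment> \<open>The linear term steers the subgradient towards \<open>w\<close>, and the second
    term holds \<open>N p\<close> near \<open>N x0\<close>.\<close>
  define q where "q = (\<lambda>y. - (w \<bullet> y) + 1 / (2 * \<epsilon>) * (norm (N (y - x0)))\<^sup>2 + \<epsilon> / 2 * (norm y)\<^sup>2)"
  obtain p \<rho> where p: "(p, \<rho>) \<in> E" and min: "\<And>y s. (y, s) \<in> E \<Longrightarrow> \<rho> + q p \<le> s + q y"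
  proof (rule minimizer_exists[of q "\<epsilon> / 2" "- w" 0])
    show "continuous_on UNIV q"
      unfolding q_def by (intro continuous_intros continuous_on_compose2[OF continuous_N[of UNIV]]) auto
    show "\<epsilon> / 2 * (norm x)\<^sup>2 + - w \<bullet> x - 0 \<le> q x" for x
      using \<epsilon> by (simp add: q_def)
  qed (use \<epsilon> in auto)
  \<comment> \<open>\<open>g\<close> is the gradient of \<open>q\<close> at \<open>p\<close>. In
    \<open>- g\<close> the second term lies in the range of \<open>N\<close>, so the complementary
    part contains only \<open>w\<close> and a multiple \<open>\<epsilon>\<close> of that of
    \<open>p\<close>.\<close>
  define g where "g = - w + (1 / \<epsilon>) *\<^sub>R N (p - x0) + \<epsilon> *\<^sub>R p"
  have "q y \<le> q p + g \<bullet> (y - p) + (1 / (2 * \<epsilon>) + \<epsilon> / 2) * (norm (y - p))\<^sup>2" for y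
  proof -
    have "(norm (N (y - x0)))\<^sup>2 = (norm (N (p - x0) + N (y - p)))\<^sup>2"
      by (simp add: N_simps)
    also have "\<dots> = (norm (N (p - x0)))\<^sup>2 + 2 * (N (p - x0) \<bullet> (y - p)) + (norm (N (y - p)))\<^sup>2"
    proof -
      have "N (p - x0) \<bullet> N (y - p) = N (p - x0) \<bullet> (y - p)"
        by (metis idem self_adjoint)
      then show ?thesis
        unfolding power2_norm_eq_inner inner_add_left inner_add_right
          inner_commute[of "N (y - p)" "N (p - x0)"] by simp
    qed
    also have "\<dots> \<le> (norm (N (p - x0)))\<^sup>2 + 2 * (N (p - x0) \<bullet> (y - p)) + (norm (y - p))\<^sup>2"
      using norm_N_le by simp
    finally have 1: "1 / (2 * \<epsilon>) * (norm (N (y - x0)))\<^sup>2 \<le> 1 / (2 * \<epsilon>) *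
        ((norm (N (p - x0)))\<^sup>2 + 2 * (N (p - x0) \<bullet> (y - p)) + (norm (y - p))\<^sup>2)"
      using \<epsilon> by (intro mult_left_mono) auto
    have 2: "(norm y)\<^sup>2 = (norm p)\<^sup>2 + 2 * (p \<bullet> (y - p)) + (norm (y - p))\<^sup>2"
      unfolding power2_norm_eq_inner by (simp add: algebra_simps inner_commute)
    have "q y \<le> - (w \<bullet> y) + 1 / (2 * \<epsilon>) *
        ((norm (N (p - x0)))\<^sup>2 + 2 * (N (p - x0) \<bullet> (y - p)) + (norm (y - p))\<^sup>2)
        + \<epsilon> / 2 * ((norm p)\<^sup>2 + 2 * (p \<bullet> (y - p)) + (norm (y - p))\<^sup>2)"
      unfolding q_def 2 using 1 by simp
    also have "\<dots> = q p + g \<bullet> (y - p) + (1 / (2 * \<epsilon>) + \<epsilon> / 2) * (norm (y - p))\<^sup>2"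
      using \<epsilon> by (simp add: q_def g_def inner_add_left inner_diff_left inner_diff_right[of w]
          distrib_left distrib_right)
    finally show ?thesis .
  qed
  then have sub: "subgradient p (- g)"
    unfolding subgradient_def using p minimizer_optimality[where q = q, OF p min] by blast
  define \<nu> where "\<nu> = norm (N p - N x0)"
  \<comment> \<open>At \<open>x0\<close> the second term of \<open>q\<close> vanishes, and
    \<open>M\<close> bounds \<open>\<rho>\<close> from below. Multiplying by
    \<open>2 * \<epsilon>\<close> and completing the square in \<open>\<nu>\<close> gives the bound;
    the \<open>B\<^sup>2\<close> in \<open>Q\<close> pays for the square.\<close>
  have "(\<nu> - \<epsilon> * B)\<^sup>2 + (\<epsilon> * norm p)\<^sup>2 \<le> \<epsilon> * Q"
  proof -
    have "- (B * \<nu>) \<le> u0 \<bullet> (N p - N x0)"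
      using Cauchy_Schwarz_ineq2[of u0 "N p - N x0"] unfolding B_def \<nu>_def by linarith
    moreover have "u0 \<bullet> p - w \<bullet> p = u0 \<bullet> N p"
      by (simp add: w_def inner_diff_left self_adjoint)
    moreover have "\<rho> + (- (w \<bullet> p) + 1 / (2 * \<epsilon>) * \<nu>\<^sup>2 + \<epsilon> / 2 * (norm p)\<^sup>2)
        \<le> r0 + (- (w \<bullet> x0) + \<epsilon> / 2 * (norm x0)\<^sup>2)"
      using min[OF r0] by (simp add: q_def N_simps \<nu>_def)
    moreover have "\<epsilon> / 2 * (norm x0)\<^sup>2 \<le> 1 * (norm x0)\<^sup>2"
      using \<epsilon> by (intro mult_right_mono) auto
    ultimately have "1 / (2 * \<epsilon>) * \<nu>\<^sup>2 - B * \<nu> + \<epsilon> / 2 * (norm p)\<^sup>2 \<le> C"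
      using M[OF p] unfolding C_def by (simp add: inner_diff_right)
    then have "(2 * \<epsilon>) * (1 / (2 * \<epsilon>) * \<nu>\<^sup>2 - B * \<nu> + \<epsilon> / 2 * (norm p)\<^sup>2) \<le> (2 * \<epsilon>) * C"
      using \<epsilon> by (intro mult_left_mono) auto
    then have "\<nu>\<^sup>2 - 2 * \<epsilon> * B * \<nu> + (\<epsilon> * norm p)\<^sup>2 \<le> 2 * \<epsilon> * C"
      using \<epsilon> by (simp add: algebra_simps power2_eq_square)
    moreover have "\<epsilon>\<^sup>2 * B\<^sup>2 \<le> \<epsilon> * B\<^sup>2"
      using \<epsilon> by (intro mult_right_mono) (auto simp: power2_eq_square mult_left_le)
    ultimately show ?thesis
      by (simp add: Q_def power2_diff power_mult_distrib algebra_simps)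
  qed
  then have "(\<nu> - \<epsilon> * B)\<^sup>2 \<le> \<epsilon> * Q" "(\<epsilon> * norm p)\<^sup>2 \<le> \<epsilon> * Q"
    using zero_le_power2[of "\<nu> - \<epsilon> * B"] zero_le_power2[of "\<epsilon> * norm p"] by linarith+
  then have "\<nu> - \<epsilon> * B \<le> sqrt (\<epsilon> * Q)" "\<epsilon> * norm p \<le> sqrt (\<epsilon> * Q)"
    by (auto intro: real_le_rsqrt)
  moreover have "0 \<le> \<epsilon> * B"
    using \<epsilon> by (simp add: B_def)
  ultimately have "\<nu> < e" "\<epsilon> * norm p < e"
    using \<epsilon> by linarith+
  moreover have "((- g) - N (- g)) - (u0 - N u0) = - \<epsilon> *\<^sub>R (p - N p)"
    using \<epsilon> linear_neg[OF linear_N]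
    by (simp add: g_def w_def N_simps idem algebra_simps)
  then have "norm (((- g) - N (- g)) - (u0 - N u0)) \<le> \<epsilon> * norm p"
    using norm_complement_le[of p] \<epsilon> by simp
  ultimately show ?thesis
    using that[OF sub] unfolding \<nu>_def by linarith
qed

end

section \<open>Steps of Douglas-Rachford orbits\<close>

text \<open>The squared distance of the two orbits decreases to a limit, so its decrements tend to
  \<open>0\<close>; they dominate the squared differences of the steps.\<close>

lemma firmly_nonexpansive_orbits:
  fixes F :: "'a::real_inner \<Rightarrow> 'a"
  assumes "\<And>x y. (norm (F x - F y))\<^sup>2 + (norm ((x - F x) - (y - F y)))\<^sup>2 \<le> (norm (x - y))\<^sup>2"
  shows "(\<lambda>k. ((F ^^ k) x - (F ^^ Suc k) x) - ((F ^^ k) y - (F ^^ Suc k) y)) \<longlonglongrightarrow> 0"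
proof -
  define d where "d k = (norm ((F ^^ k) x - (F ^^ k) y))\<^sup>2" for k
  define e where "e k = (norm (((F ^^ k) x - (F ^^ Suc k) x) - ((F ^^ k) y - (F ^^ Suc k) y)))\<^sup>2" for k
  have step: "e k \<le> d k - d (Suc k)" for k
    using assms[of "(F ^^ k) x" "(F ^^ k) y"] by (simp add: d_def e_def)
  have e0: "e k \<ge> 0" for k
    by (simp add: e_def)
  have dec: "decseq d"
    unfolding decseq_Suc_iff using step e0 by (metis diff_ge_0_iff_ge order_trans)
  obtain L where L: "d \<longlonglongrightarrow> L"
    using decseq_convergent[OF dec, of 0] by (auto simp: d_def)
  have "(\<lambda>k. d k - d (Suc k)) \<longlonglongrightarrow> L - L"
    by (intro tendsto_diff L LIMSEQ_Suc)
  then have "e \<longlonglongrightarrow> 0"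
    using step e0 by (intro real_tendsto_sandwich[where f = "\<lambda>_. 0" and g = e]) auto
  then have "(\<lambda>k. sqrt (e k)) \<longlonglongrightarrow> sqrt 0"
    by (rule tendsto_real_sqrt)
  then show ?thesis
    unfolding e_def by (simp add: tendsto_norm_zero_iff)
qed

section \<open>Shortest vectors of convex sets\<close>

definition least_norm :: "'a::euclidean_space set \<Rightarrow> 'a" where
  "least_norm C = closest_point (closure C) 0"

text \<open>The gap sets need not be closed, hence the closures. The last bound is the obtuse-angle
  inequality for the projection of \<open>0\<close>: points of \<open>C\<close> of nearly minimal
  norm are close to \<open>least_norm C\<close>.\<close>

lemma
  assumes "convex C" "C \<noteq> {}"
  shows least_norm_in_closure: "least_norm C \<in> closure C"
    and least_norm_le: "c \<in> C \<Longrightarrow> norm (least_norm C) \<le> norm c"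
    and least_norm_dist: "c \<in> C \<Longrightarrow>
      (norm (c - least_norm C))\<^sup>2 \<le> (norm c)\<^sup>2 - (norm (least_norm C))\<^sup>2"
proof -
  show "least_norm C \<in> closure C"
    unfolding least_norm_def using assms by (intro closest_point_in_set) auto
  assume c: "c \<in> C"
  then have cC: "c \<in> closure C"
    using closure_subset by blast
  show "norm (least_norm C) \<le> norm c"
    unfolding least_norm_def using closest_point_le[OF closed_closure cC, of 0] by simp
  have "(0 - least_norm C) \<bullet> (c - least_norm C) \<le> 0"
    unfolding least_norm_def
    by (rule closest_point_dot[OF convex_closure[OF assms(1)] closed_closure cC])
  then show "(norm (c - least_norm C))\<^sup>2 \<le> (norm c)\<^sup>2 - (norm (least_norm C))\<^sup>2"
    unfolding power2_norm_eq_inner by (simp add: algebra_simps inner_commute)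
qed

section \<open>Residuals of the DRS map as orthogonal sums of gaps\<close>

locale drs_splitting = epigraph_with_projector E N
  for E :: "('a::euclidean_space \<times> real) set" and N :: "'a \<Rightarrow> 'a" +
  fixes a :: 'a and t :: real and P :: "'a \<Rightarrow> 'a"
  assumes N_a: "N a = a" and t: "t > 0"
    and P: "subgradient (P v) ((v - P v) /\<^sub>R t)"
begin

text \<open>The map taking \<open>x\<close> to \<open>x - N x + a\<close> projects onto
  \<open>{x. N x = a}\<close>; here it is applied to the reflected proximal point.\<close>

definition F :: "'a \<Rightarrow> 'a" where
  "F v = v + ((2 *\<^sub>R P v - v) - N (2 *\<^sub>R P v - v) + a) - P v"

text \<open>\<open>N x - a\<close> is \<open>x\<close> minus its projection onto
  \<open>{x. N x = a}\<close>.\<close>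

definition primal_gaps :: "'a set" where
  "primal_gaps = (\<lambda>x. N x - a) ` effdom"

definition dual_gaps :: "'a set" where
  "dual_gaps = (\<lambda>u. u - N u) ` conjugate_dom"

definition displacement :: 'a where
  "displacement = t *\<^sub>R least_norm dual_gaps + least_norm primal_gaps"

lemma gaps_nonempty: "primal_gaps \<noteq> {}" "dual_gaps \<noteq> {}"
  using effdom_nonempty conjugate_dom_nonempty by (auto simp: primal_gaps_def dual_gaps_def)

lemma convex_gaps: "convex primal_gaps" "convex dual_gaps"
proof -
  have "primal_gaps = (\<lambda>x. - a + x) ` N ` effdom"
    unfolding primal_gaps_def by (simp add: image_image)
  then show "convex primal_gaps"
    using convex_translation[OF convex_linear_image[OF linear_N convex_effdom]] by simp
  have "linear (\<lambda>u. u - N u)"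
    by (intro linear_compose_sub linear_N linear_ident)
  then show "convex dual_gaps"
    unfolding dual_gaps_def by (intro convex_linear_image convex_conjugate_dom)
qed

text \<open>The equations hold on the gap sets and pass to the closures by continuity of
  \<open>N\<close>.\<close>

lemma N_least_norm:
  "N (least_norm primal_gaps) = least_norm primal_gaps" "N (least_norm dual_gaps) = 0"
proof -
  have "closure primal_gaps \<subseteq> {x. N x = x}"
    by (intro closure_minimal closed_Collect_eq continuous_N continuous_on_id)
      (auto simp: primal_gaps_def N_simps idem N_a)
  moreover have "closure dual_gaps \<subseteq> {x. N x = 0}"
    by (intro closure_minimal closed_Collect_eq continuous_N continuous_on_const)
      (auto simp: dual_gaps_def N_simps idem)
  ultimately show "N (least_norm primal_gaps) = least_norm primal_gaps" "N (least_norm dual_gaps) = 0"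
    using least_norm_in_closure[OF convex_gaps(1) gaps_nonempty(1)]
      least_norm_in_closure[OF convex_gaps(2) gaps_nonempty(2)] by auto
qed

lemma N_displacement: "N displacement = least_norm primal_gaps"
  by (simp add: displacement_def N_simps N_least_norm)

lemma norm_orthogonal:
  assumes "N x = x" "N y = 0"
  shows "(norm (t *\<^sub>R y + x))\<^sup>2 = t\<^sup>2 * (norm y)\<^sup>2 + (norm x)\<^sup>2"
proof -
  have "x \<bullet> y = 0"
    by (metis assms self_adjoint inner_zero_right)
  then show ?thesis
    unfolding power2_norm_eq_inner
    by (simp add: inner_add_left inner_add_right inner_commute power2_eq_square)
qed

lemma norm_displacement:
  "(norm displacement)\<^sup>2 = t\<^sup>2 * (norm (least_norm dual_gaps))\<^sup>2 + (norm (least_norm primal_gaps))\<^sup>2"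
  unfolding displacement_def by (rule norm_orthogonal) (fact N_least_norm)+

lemma residual:
  "v - F v = t *\<^sub>R ((v - P v) /\<^sub>R t - N ((v - P v) /\<^sub>R t)) + (N (P v) - a)"
proof -
  have "t *\<^sub>R ((v - P v) /\<^sub>R t - N ((v - P v) /\<^sub>R t)) = (v - P v) - N (v - P v)"
    using t by (simp add: N_simps(3) flip: scaleR_diff_right)
  then show ?thesis
    unfolding F_def by (simp add: N_simps scaleR_2)
qed

text \<open>Monotonicity of subgradients forces the two points to coincide. Thus every subgradient
  pair arises from some \<open>v\<close>, namely \<open>p + t *\<^sub>R u\<close>.\<close>

lemma P_unique:
  assumes "subgradient p u" shows "P (p + t *\<^sub>R u) = p"
proof -
  let ?q = "P (p + t *\<^sub>R u)"
  have "0 \<le> ((p + t *\<^sub>R u - ?q) /\<^sub>R t - u) \<bullet> (?q - p)"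
    by (rule subgradient_monotone[OF P assms])
  also have "(p + t *\<^sub>R u - ?q) /\<^sub>R t - u = - ((?q - p) /\<^sub>R t)"
    using t by (simp add: algebra_simps)
  finally have "(?q - p) \<bullet> (?q - p) / t \<le> 0"
    by (simp add: divide_inverse mult.commute)
  then have "(?q - p) \<bullet> (?q - p) \<le> 0"
    using t by (simp add: divide_le_0_iff)
  then show ?thesis
    by (metis eq_iff_diff_eq_0 inner_ge_zero inner_eq_zero_iff order_antisym)
qed

lemma N_residual: "N (v - F v) = N (P v) - a"
  unfolding residual by (simp add: N_simps idem N_a)

text \<open>By orthogonality of the \<open>N\<close>-parts and the complementary parts, the mixed
  inner product of the two differences collapses to \<open>\<Delta>u \<bullet> \<Delta>p\<close>,
  which monotonicity makes nonnegative.\<close>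

lemma F_firmly_nonexpansive:
  "(norm (F x - F y))\<^sup>2 + (norm ((x - F x) - (y - F y)))\<^sup>2 \<le> (norm (x - y))\<^sup>2"
proof -
  define \<Delta>p where "\<Delta>p = P x - P y"
  define \<Delta>u where "\<Delta>u = (x - P x) - (y - P y)"
  have mono: "0 \<le> \<Delta>u \<bullet> \<Delta>p"
  proof -
    have "0 \<le> ((x - P x) /\<^sub>R t - (y - P y) /\<^sub>R t) \<bullet> (P x - P y)"
      by (rule subgradient_monotone[OF P P])
    also have "\<dots> = (\<Delta>u \<bullet> \<Delta>p) / t"
      by (simp add: \<Delta>u_def \<Delta>p_def divide_inverse mult.commute flip: scaleR_diff_right)
    finally show ?thesis
      using t by (simp add: zero_le_divide_iff)
  qed
  have I: "(x - F x) - (y - F y) = (\<Delta>u - N \<Delta>u) + N \<Delta>p"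
    unfolding F_def \<Delta>u_def \<Delta>p_def by (simp add: N_simps scaleR_2 algebra_simps)
  have T: "F x - F y = (\<Delta>p - N \<Delta>p) + N \<Delta>u"
    unfolding F_def \<Delta>u_def \<Delta>p_def by (simp add: N_simps scaleR_2 algebra_simps)
  have "(F x - F y) \<bullet> ((x - F x) - (y - F y)) = (\<Delta>p - N \<Delta>p) \<bullet> (\<Delta>u - N \<Delta>u) + N \<Delta>u \<bullet> N \<Delta>p"
    unfolding I T inner_add_left inner_add_right using orthogonal_parts[of \<Delta>u \<Delta>u]
      orthogonal_parts[of \<Delta>p \<Delta>p] by (simp add: inner_commute)
  also have "\<dots> = \<Delta>u \<bullet> \<Delta>p"
  proof -
    have "(\<Delta>p - N \<Delta>p) \<bullet> (\<Delta>u - N \<Delta>u) = \<Delta>p \<bullet> (\<Delta>u - N \<Delta>u)"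
      using orthogonal_parts[of \<Delta>p \<Delta>u] by (simp add: inner_diff_left)
    moreover have "N \<Delta>u \<bullet> N \<Delta>p = \<Delta>p \<bullet> N \<Delta>u"
      by (metis idem inner_commute self_adjoint)
    ultimately show ?thesis
      by (simp add: inner_diff_right inner_commute)
  qed
  finally have "0 \<le> (F x - F y) \<bullet> ((x - F x) - (y - F y))"
    using mono by simp
  moreover have "x - y = (F x - F y) + ((x - F x) - (y - F y))"
    by simp
  then have "(norm (x - y))\<^sup>2 = (norm (F x - F y))\<^sup>2 + (norm ((x - F x) - (y - F y)))\<^sup>2
      + 2 * ((F x - F y) \<bullet> ((x - F x) - (y - F y)))"
    by (simp add: power2_norm_eq_inner algebra_simps inner_commute)
  ultimately show ?thesis by simp
qed

lemma residual_gaps: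
  obtains p q where "v - F v = t *\<^sub>R q + p" "p \<in> primal_gaps" "q \<in> dual_gaps" "N p = p" "N q = 0"
proof
  show "v - F v = t *\<^sub>R ((v - P v) /\<^sub>R t - N ((v - P v) /\<^sub>R t)) + (N (P v) - a)"
    by (rule residual)
  show "N (P v) - a \<in> primal_gaps"
    unfolding primal_gaps_def using subgradient_effdom[OF P] by blast
  show "(v - P v) /\<^sub>R t - N ((v - P v) /\<^sub>R t) \<in> dual_gaps"
    unfolding dual_gaps_def using subgradient_conjugate_dom[OF P] by blast
qed (simp_all add: N_simps idem N_a)

text \<open>The obtuse-angle bound is applied in each of the two orthogonal components and the
  results are added.\<close>

lemma displacement_dist:
  "(norm (v - F v - displacement))\<^sup>2 \<le> (norm (v - F v))\<^sup>2 - (norm displacement)\<^sup>2"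
proof -
  obtain p q where v: "v - F v = t *\<^sub>R q + p" and pq: "p \<in> primal_gaps" "q \<in> dual_gaps"
    "N p = p" "N q = 0"
    by (rule residual_gaps)
  let ?p = "least_norm primal_gaps" and ?q = "least_norm dual_gaps"
  have "v - F v - displacement = t *\<^sub>R (q - ?q) + (p - ?p)"
    by (simp add: v displacement_def algebra_simps)
  then have "(norm (v - F v - displacement))\<^sup>2 = t\<^sup>2 * (norm (q - ?q))\<^sup>2 + (norm (p - ?p))\<^sup>2"
    using pq by (simp add: norm_orthogonal N_simps N_least_norm)
  also have "\<dots> \<le> t\<^sup>2 * ((norm q)\<^sup>2 - (norm ?q)\<^sup>2) + ((norm p)\<^sup>2 - (norm ?p)\<^sup>2)"
    using pq by (intro add_mono mult_left_mono least_norm_dist convex_gaps gaps_nonempty) auto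
  also have "\<dots> = (norm (v - F v))\<^sup>2 - (norm displacement)\<^sup>2"
    unfolding v norm_orthogonal[OF pq(3,4)] norm_displacement by (simp add: algebra_simps)
  finally show ?thesis .
qed

lemma norm_displacement_le: "norm displacement \<le> norm (v - F v)"
proof -
  have "(norm displacement)\<^sup>2 \<le> (norm (v - F v))\<^sup>2"
    using displacement_dist[of v] zero_le_power2[of "norm (v - F v - displacement)"] by linarith
  then show ?thesis by simp
qed

text \<open>Gaps near the two shortest vectors come from unrelated \<open>x0\<close> and
  \<open>u0\<close>; a single subgradient pair close to both gaps realizes them together as one
  residual.\<close>

lemma residual_near_displacement:
  assumes "e > 0" obtains v where "norm (v - F v - displacement) < e"
proof -
  \<comment> \<open>Four errors below \<open>\<delta>\<close> occur, two of them multiplied by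
    \<open>t\<close>.\<close>
  define \<delta> where "\<delta> = e / (2 * t + 2)"
  have \<delta>: "\<delta> > 0" using assms t by (simp add: \<delta>_def)
  let ?p = "least_norm primal_gaps" and ?q = "least_norm dual_gaps"
  obtain x0 where x0: "x0 \<in> effdom" "norm (N x0 - a - ?p) < \<delta>"
    using least_norm_in_closure[OF convex_gaps(1) gaps_nonempty(1)] \<delta>
    unfolding closure_approachable primal_gaps_def dist_norm by blast
  obtain u0 where u0: "u0 \<in> conjugate_dom" "norm (u0 - N u0 - ?q) < \<delta>"
    using least_norm_in_closure[OF convex_gaps(2) gaps_nonempty(2)] \<delta>
    unfolding closure_approachable dual_gaps_def dist_norm by blast
  obtain p u where pu: "subgradient p u" "norm (N p - N x0) < \<delta>"
    "norm ((u - N u) - (u0 - N u0)) < \<delta>"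
    using subgradient_approximation[OF x0(1) u0(1) \<delta>] by blast
  define v where "v = p + t *\<^sub>R u"
  have "P v = p"
    unfolding v_def by (rule P_unique[OF pu(1)])
  then have "v - F v = t *\<^sub>R (u - N u) + (N p - a)"
    using t by (simp add: residual v_def)
  then have "v - F v - displacement = t *\<^sub>R (((u - N u) - (u0 - N u0)) + (u0 - N u0 - ?q))
      + ((N p - N x0) + (N x0 - a - ?p))" (is "_ = t *\<^sub>R (?q1 + ?q2) + (?p1 + ?p2)")
    by (simp add: displacement_def algebra_simps)
  also have "norm \<dots> \<le> t * norm (?q1 + ?q2) + norm (?p1 + ?p2)"
    using norm_triangle_ineq[of "t *\<^sub>R (?q1 + ?q2)" "?p1 + ?p2"] t by simp
  also have "\<dots> \<le> t * (norm ?q1 + norm ?q2) + (norm ?p1 + norm ?p2)"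
    by (rule add_mono[OF mult_left_mono[OF norm_triangle_ineq less_imp_le[OF t]] norm_triangle_ineq])
  also have "\<dots> < t * (\<delta> + \<delta>) + (\<delta> + \<delta>)"
    by (rule add_strict_mono[OF mult_strict_left_mono[OF add_strict_mono[OF pu(3) u0(2)] t]
          add_strict_mono[OF pu(2) x0(2)]])
  also have "\<dots> = \<delta> * (2 * t + 2)"
    by (simp add: algebra_simps)
  also have "\<dots> = e"
    using t by (simp add: \<delta>_def)
  finally show ?thesis by (rule that)
qed

lemma F_nonexpansive: "norm (F x - F y) \<le> norm (x - y)"
proof -
  have "(norm (F x - F y))\<^sup>2 \<le> (norm (x - y))\<^sup>2"
    using F_firmly_nonexpansive[of x y] zero_le_power2[of "norm ((x - F x) - (y - F y))"] by linarith
  then show ?thesis by simp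
qed

lemma orbit_step_le: "norm ((F ^^ k) y - (F ^^ Suc k) y) \<le> norm (y - F y)"
proof (induction k)
  case (Suc k)
  then show ?case
    using F_nonexpansive[of "(F ^^ k) y" "(F ^^ Suc k) y"] by simp
qed simp

lemma orbit_steps_tendsto: "(\<lambda>k. (F ^^ k) x - (F ^^ Suc k) x) \<longlonglongrightarrow> displacement"
proof -
  let ?s = "\<lambda>x k. (F ^^ k) x - (F ^^ Suc k) x"
  have "(\<lambda>k. norm (?s x k)) \<longlonglongrightarrow> norm displacement"
  proof (rule order_tendstoI)
    fix c assume "c < norm displacement"
    then show "\<forall>\<^sub>F k in sequentially. c < norm (?s x k)"
      using norm_displacement_le[of "(F ^^ k) x" for k]
      by (intro always_eventually allI) (simp add: less_le_trans)
  next
    fix c assume c: "norm displacement < c"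
    \<comment> \<open>Half of the margin pays for the first step of \<open>y\<close>, half for the
      difference between the steps of the two orbits.\<close>
    define e where "e = (c - norm displacement) / 2"
    have e: "e > 0" using c by (simp add: e_def)
    obtain y where y: "norm (y - F y - displacement) < e"
      by (rule residual_near_displacement[OF e])
    have "\<forall>\<^sub>F k in sequentially. norm (?s x k - ?s y k) < e"
      using tendstoD[OF firmly_nonexpansive_orbits[of F x y, OF F_firmly_nonexpansive] e] by simp
    then show "\<forall>\<^sub>F k in sequentially. norm (?s x k) < c"
    proof eventually_elim
      case (elim k)
      have "norm (?s x k) \<le> norm (?s x k - ?s y k) + norm (?s y k)"
        using norm_triangle_ineq[of "?s x k - ?s y k" "?s y k"] by simp
      also have "norm (?s y k) \<le> norm (y - F y - displacement) + norm displacement"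
        using orbit_step_le[of k y] norm_triangle_ineq[of "y - F y - displacement" displacement]
        by simp
      finally show ?case
        using elim y by (simp add: e_def)
    qed
  qed
  then have "(\<lambda>k. (norm (?s x k))\<^sup>2 - (norm displacement)\<^sup>2) \<longlonglongrightarrow> (norm displacement)\<^sup>2 - (norm displacement)\<^sup>2"
    by (rule tendsto_diff[OF tendsto_power tendsto_const])
  then have lim: "(\<lambda>k. (norm (?s x k))\<^sup>2 - (norm displacement)\<^sup>2) \<longlonglongrightarrow> 0"
    unfolding diff_self .
  have bound: "(norm (?s x k - displacement))\<^sup>2 \<le> (norm (?s x k))\<^sup>2 - (norm displacement)\<^sup>2" for k
    using displacement_dist[of "(F ^^ k) x"] by simp
  have "(\<lambda>k. (norm (?s x k - displacement))\<^sup>2) \<longlonglongrightarrow> 0"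
    by (rule real_tendsto_sandwich[OF _ _ tendsto_const lim])
      (intro always_eventually allI zero_le_power2 bound)+
  then have "(\<lambda>k. sqrt ((norm (?s x k - displacement))\<^sup>2)) \<longlonglongrightarrow> sqrt 0"
    by (rule tendsto_real_sqrt)
  then show ?thesis
    by (simp add: tendsto_norm_zero_iff LIM_zero_iff)
qed

text \<open>The direction is \<open>- w\<close> for \<open>w = least_norm dual_gaps\<close>. The
  obtuse-angle inequality gives \<open>u \<bullet> w \<ge> (norm w)\<^sup>2\<close> on all of
  \<open>conjugate_dom\<close>, so the rate is \<open>\<sigma> = (norm w)\<^sup>2\<close>.\<close>

lemma recession_descent:
  assumes pos: "least_norm dual_gaps \<noteq> 0"
  obtains d \<sigma> where "\<sigma> > 0" "N d = 0"
    "\<forall>x r s. (x, r) \<in> E \<longrightarrow> s \<ge> 0 \<longrightarrow> (x + s *\<^sub>R d, r - s * \<sigma>) \<in> E"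
proof
  let ?w = "least_norm dual_gaps"
  show "(norm ?w)\<^sup>2 > 0"
    using pos by simp
  show Nd: "N (- ?w) = 0"
    using N_least_norm(2) linear_neg[OF linear_N] by simp
  have "u \<bullet> (- ?w) \<le> - (norm ?w)\<^sup>2" if u: "u \<in> conjugate_dom" for u
  proof -
    let ?c = "u - N u"
    have "(norm (?c - ?w))\<^sup>2 \<le> (norm ?c)\<^sup>2 - (norm ?w)\<^sup>2"
      using u by (intro least_norm_dist convex_gaps gaps_nonempty) (auto simp: dual_gaps_def)
    then have "(norm ?w)\<^sup>2 \<le> ?c \<bullet> ?w"
      unfolding power2_norm_eq_inner by (simp add: inner_diff_left inner_diff_right inner_commute)
    also have "\<dots> = u \<bullet> ?w"
      by (simp add: inner_diff_left self_adjoint N_least_norm)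
    finally show ?thesis by simp
  qed
  from recession_direction[OF this]
  show "\<forall>x r s. (x, r) \<in> E \<longrightarrow> s \<ge> 0 \<longrightarrow> (x + s *\<^sub>R (- ?w), r - s * (norm ?w)\<^sup>2) \<in> E"
    by simp
qed

end

section \<open>A2DR on pathological problems\<close>

text \<open>A check that succeeds with a large counter \<open>nAA\<close> would make the residual smaller than \<open>\<mu>\<close>. Hence
  either the counter stays bounded, or from some point on every check fails, and after at most \<open>R\<close>
  more unchecked steps only plain DRS steps are taken.\<close>
lemma a2dr_eventually_drs:
  assumes run: "a2dr_run f A b v0 t \<eta> D \<epsilon> R Mmax v" and \<epsilon>: "\<epsilon> > 0" and R: "R \<ge> 1"
    and \<mu>: "\<mu> > 0" "\<And>x. \<mu> \<le> norm (x - F_DRS f A b t x)"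
  obtains K where "\<And>k. k \<ge> K \<Longrightarrow> v (Suc k) = F_DRS f A b t (v k)"
proof -
  let ?F = "F_DRS f A b t"
  obtain vDRS vAA g nAA RAA I where
    step: "\<And>k. k \<ge> 1 \<Longrightarrow> vDRS (k + 1) = ?F (v k) \<and> g k = v k - vDRS (k + 1) \<and>
      (if I k \<or> R \<le> RAA k
       then if norm (g k) \<le> D * norm (g 0) * (real (nAA k) / real R + 1) powr (- (1 + \<epsilon>))
            then v (k + 1) = vAA (k + 1) \<and> nAA (k + 1) = nAA k + 1 \<and>
                 RAA (k + 1) = 1 \<and> \<not> I (k + 1)
            else v (k + 1) = vDRS (k + 1) \<and> nAA (k + 1) = nAA k \<and>
                 RAA (k + 1) = 0 \<and> I (k + 1)
       else v (k + 1) = vAA (k + 1) \<and> nAA (k + 1) = nAA k + 1 \<and>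
            RAA (k + 1) = RAA k + 1 \<and> \<not> I (k + 1 :: nat))"
    using run unfolding a2dr_run_def Let_def by (elim exE conjE) blast
  \<comment> \<open>Every branch either raises the counter or takes a plain DRS step.\<close>
  have mono: "nAA k \<le> nAA (Suc k)" "nAA (Suc k) = nAA k \<Longrightarrow> v (Suc k) = ?F (v k)" if "k \<ge> 1" for k
    using step[OF that] by (auto split: if_splits)
  have mono_le: "nAA j \<le> nAA k" if "1 \<le> j" "j \<le> k" for j k
    using that(2) by (induction k rule: dec_induct) (use mono that(1) in \<open>auto intro: order_trans\<close>)
  show ?thesis
  proof (cases "\<exists>n. \<forall>k\<ge>1. nAA k \<le> n")
    case True
    \<comment> \<open>A bounded nondecreasing counter reaches its maximum and is constant from there
      on.\<close>
    define n where "n = Max (nAA ` {1..})"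
    have fin: "finite (nAA ` {1..})"
      using True by (auto intro: finite_subset[of _ "{..n}" for n])
    obtain K where K: "K \<ge> 1" "nAA K = n"
      using Max_in[OF fin] unfolding n_def by auto
    have "nAA k = n" if "k \<ge> K" for k
      using mono_le[OF K(1) that] Max_ge[OF fin, of "nAA k"] K that by (auto simp: n_def)
    then have "v (Suc k) = ?F (v k)" if "k \<ge> K" for k
      using mono(2)[of k] that K by simp
    then show ?thesis by (rule that)
  next
    case False
    \<comment> \<open>The negative exponent drives the safeguard threshold to \<open>0\<close>,
      hence below \<open>\<mu>\<close>, as the counter grows.\<close>
    have "((\<lambda>n. D * norm (g 0) * (real n / real R + 1) powr (- (1 + \<epsilon>))) \<longlongrightarrow> D * norm (g 0) * 0) sequentially"
    proof (intro tendsto_mult tendsto_const tendsto_neg_powr)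
      show "filterlim (\<lambda>n. real n / real R + 1) at_top sequentially"
        using R by real_asymp
    qed (use \<epsilon> in auto)
    then have "\<forall>\<^sub>F n in sequentially. D * norm (g 0) * (real n / real R + 1) powr (- (1 + \<epsilon>)) < \<mu>"
      using \<mu>(1) by (auto dest: order_tendstoD)
    then obtain n0 where n0: "\<And>n. n \<ge> n0 \<Longrightarrow> D * norm (g 0) * (real n / real R + 1) powr (- (1 + \<epsilon>)) < \<mu>"
      unfolding eventually_sequentially by blast
    obtain k0 where k0: "k0 \<ge> 1" "nAA k0 \<ge> n0"
      using False by (meson nat_le_linear)
    have fails: "\<not> norm (g k) \<le> D * norm (g 0) * (real (nAA k) / real R + 1) powr (- (1 + \<epsilon>))"
      if "k \<ge> k0" for k
      using n0[of "nAA k"] mono_le[OF k0(1) that] k0 that \<mu>(2)[of "v k"] step[of k] by auto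
    \<comment> \<open>Between checks \<open>RAA\<close> grows by one per step, so it cannot stay
      below \<open>R\<close>.\<close>
    have "\<exists>k\<ge>k0. I k \<or> R \<le> RAA k"
    proof (rule ccontr)
      assume none: "\<not> ?thesis"
      then have "RAA (Suc k) = Suc (RAA k)" if "k \<ge> k0" for k
        using step[of k] that k0 by auto
      then have "RAA (k0 + j) = RAA k0 + j" for j
        by (induction j) auto
      then show False
        using none by (metis le_add1 le_add2)
    qed
    then obtain K where K: "K \<ge> k0" "I K \<or> R \<le> RAA K" by blast
    have next_step: "v (Suc k) = ?F (v k) \<and> I (Suc k)" if "k \<ge> k0" "I k \<or> R \<le> RAA k" for k
      using step[of k] fails[OF that(1)] that k0 by auto
    \<comment> \<open>A failed check sets the flag, so the next step is checked as well and fails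
      again.\<close>
    have "I k \<or> R \<le> RAA k" if "k \<ge> K" for k
      using that by (induction k rule: dec_induct) (use K next_step in auto)
    then have "v (Suc k) = ?F (v k)" if "k \<ge> K" for k
      using next_step[of k] that K by simp
    then show ?thesis by (rule that)
  qed
qed

text \<open>\<open>G\<close> plays the role of a set of gap vectors. Its shortest vector may lie
  only in the closure, so the upper bound is shown up to an arbitrary \<open>e\<close>.\<close>

lemma setdist_eq_least_norm:
  fixes S T G :: "'a::euclidean_space set"
  assumes "S \<noteq> {}" "T \<noteq> {}" and G: "convex G" "G \<noteq> {}"
    and lower: "\<And>x y. x \<in> S \<Longrightarrow> y \<in> T \<Longrightarrow> \<exists>c\<in>G. norm c \<le> dist x y"
    and attained: "\<And>c. c \<in> G \<Longrightarrow> \<exists>x\<in>S. \<exists>y\<in>T. dist x y = norm c"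
  shows "setdist S T = norm (least_norm G)"
proof (rule antisym)
  show "norm (least_norm G) \<le> setdist S T"
    using assms(1,2) lower least_norm_le[OF G] by (intro le_setdistI) (auto intro: order_trans)
  show "setdist S T \<le> norm (least_norm G)"
  proof (rule field_le_epsilon)
    fix e :: real assume "e > 0"
    then obtain c where c: "c \<in> G" "dist c (least_norm G) < e"
      using least_norm_in_closure[OF G] unfolding closure_approachable by blast
    then obtain x y where "x \<in> S" "y \<in> T" "dist x y = norm c"
      using attained by blast
    then have "setdist S T \<le> norm c"
      using setdist_le_dist by metis
    also have "\<dots> \<le> norm (least_norm G) + e"
      using c(2) norm_triangle_ineq2[of c "least_norm G"] by (simp add: dist_norm)
    finally show "setdist S T \<le> norm (least_norm G) + e" .
  qed
qed

lemma closed_convex_epigraph_of_proper: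
  assumes "closed_convex_proper_on UNIV f"
  shows "closed_convex_epigraph (epigraph_on UNIV f)"
proof
  show "closed (epigraph_on UNIV f)" "convex (epigraph_on UNIV f)"
    using assms by (simp_all add: epigraph_on_def closed_convex_proper_on_def)
  show "(x, r) \<in> epigraph_on UNIV f \<Longrightarrow> r \<le> s \<Longrightarrow> (x, s) \<in> epigraph_on UNIV f" for x r s
    by (auto simp: epigraph_on_def intro: order_trans)
  obtain x r where "f x = ereal r"
  proof -
    obtain x where "f x < \<infinity>" "f x \<noteq> -\<infinity>"
      using assms by (auto simp: closed_convex_proper_on_def)
    then show ?thesis
      using that by (cases "f x") auto
  qed
  then have "(x, r) \<in> epigraph_on UNIV f" "(x, r - 1) \<notin> epigraph_on UNIV f"
    by (simp_all add: epigraph_on_def)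
  then show "\<exists>x r s. (x, r) \<in> epigraph_on UNIV f \<and> (x, s) \<notin> epigraph_on UNIV f"
    by blast
qed

text \<open>\<open>prox\<close> is a choice among minimizers, so existence comes first. Comparison
  with \<open>p\<close> makes the value of \<open>f\<close> at the chosen point finite, which
  provides the real height \<open>\<rho>\<close>.\<close>

lemma prox_minimizes:
  fixes f :: "real^'n::finite \<Rightarrow> ereal"
  assumes f: "closed_convex_proper_on UNIV f" and t: "t > 0"
  obtains \<rho> where "(prox t f v, \<rho>) \<in> epigraph_on UNIV f"
    "\<And>y s. (y, s) \<in> epigraph_on UNIV f \<Longrightarrow>
      \<rho> + 1 / (2 * t) * (norm (prox t f v - v))\<^sup>2 \<le> s + 1 / (2 * t) * (norm (y - v))\<^sup>2"
proof -
  interpret closed_convex_epigraph "epigraph_on UNIV f"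
    by (rule closed_convex_epigraph_of_proper[OF f])
  define q where "q = (\<lambda>x. 1 / (2 * t) * (norm (x - v))\<^sup>2)"
  define h where "h = (\<lambda>x. f x + ereal (q x))"
  have not_MInf: "f x \<noteq> -\<infinity>" for x
    using f by (simp add: closed_convex_proper_on_def)
  obtain p \<rho> where p: "(p, \<rho>) \<in> epigraph_on UNIV f"
    and min: "\<And>y s. (y, s) \<in> epigraph_on UNIV f \<Longrightarrow> \<rho> + q p \<le> s + q y"
    unfolding q_def using proximal_minimizer_exists[OF t] by blast
  have hp: "h p \<le> ereal (\<rho> + q p)"
    using p add_right_mono[of "f p" "ereal \<rho>" "ereal (q p)"] by (simp add: h_def epigraph_on_def)
  have "h p \<le> h y" for y
  proof (cases "f y")
    case (real s)
    then have "ereal (\<rho> + q p) \<le> h y"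
      using min[of y s] by (simp add: h_def epigraph_on_def)
    with hp show ?thesis by (rule order_trans)
  qed (use not_MInf in \<open>auto simp: h_def\<close>)
  then have "is_arg_min h (\<lambda>_. True) p"
    by (simp add: is_arg_min_def not_less)
  then have "is_arg_min h (\<lambda>_. True) (prox t f v)"
    unfolding prox_def arg_min_def h_def q_def by (rule someI)
  then have least: "h (prox t f v) \<le> h y" for y
    by (auto simp: is_arg_min_def not_less)
  then have "h (prox t f v) \<le> ereal (\<rho> + q p)"
    using hp order_trans by blast
  then have "f (prox t f v) \<noteq> \<infinity>"
    by (auto simp: h_def)
  then obtain \<sigma> where \<sigma>: "f (prox t f v) = ereal \<sigma>"
    using not_MInf by (cases "f (prox t f v)") auto
  show ?thesis
  proof (rule that)
    show "(prox t f v, \<sigma>) \<in> epigraph_on UNIV f"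
      by (simp add: epigraph_on_def \<sigma>)
    fix y s assume "(y, s) \<in> epigraph_on UNIV f"
    then have "h y \<le> ereal (s + q y)"
      using add_right_mono[of "f y" "ereal s" "ereal (q y)"] by (simp add: h_def epigraph_on_def)
    with least[of y] have "h (prox t f v) \<le> ereal (s + q y)"
      by (rule order_trans)
    then show "\<sigma> + 1 / (2 * t) * (norm (prox t f v - v))\<^sup>2 \<le> s + 1 / (2 * t) * (norm (y - v))\<^sup>2"
      by (simp add: h_def \<sigma> q_def)
  qed
qed

section \<open>The DRS map of the given problem\<close>

locale drs_problem =
  fixes f :: "real^'n::finite \<Rightarrow> ereal" and A :: "real^'n^'m::finite" and b :: "real^'m" and t :: real
  assumes f: "closed_convex_proper_on UNIV f" and feasible: "solution_set A b \<noteq> {}"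
    and t_pos: "t > 0"
begin

abbreviation "X \<equiv> pseudoinverse A"

text \<open>By the second and the fourth Penrose equation \<open>X ** A\<close> is idempotent and
  symmetric, hence an orthogonal projector.\<close>

sublocale drs_splitting "epigraph_on UNIV f" "\<lambda>x. X ** A *v x" "X *v b" t "prox t f"
proof -
  interpret closed_convex_epigraph "epigraph_on UNIV f"
    by (rule closed_convex_epigraph_of_proper[OF f])
  interpret orthogonal_projector "\<lambda>x. X ** A *v x"
  proof (rule orthogonal_projector.intro)
    show "linear (\<lambda>x. X ** A *v x)"
      by (rule matrix_vector_mul_linear)
    show "X ** A *v (X ** A *v x) = X ** A *v x" for x
      by (simp only: matrix_vector_mul_assoc matrix_mul_assoc pseudoinverse_penrose(2))
    show "(X ** A *v x) \<bullet> y = x \<bullet> (X ** A *v y)" for x y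
      by (metis dot_lmul_matrix pseudoinverse_penrose(4) transpose_matrix_vector)
  qed
  have "X ** A *v (X *v b) = X *v b"
    by (simp only: matrix_vector_mul_assoc pseudoinverse_penrose(2))
  moreover have "subgradient (prox t f v) ((v - prox t f v) /\<^sub>R t)" for v
  proof -
    obtain \<rho> where \<rho>: "(prox t f v, \<rho>) \<in> epigraph_on UNIV f"
      "\<And>y s. (y, s) \<in> epigraph_on UNIV f \<Longrightarrow>
        \<rho> + 1 / (2 * t) * (norm (prox t f v - v))\<^sup>2 \<le> s + 1 / (2 * t) * (norm (y - v))\<^sup>2"
      using prox_minimizes[OF f t_pos, where v = v] by blast
    have "\<forall>(y, s)\<in>epigraph_on UNIV f.
        s \<ge> \<rho> + ((v - prox t f v) /\<^sub>R t) \<bullet> (y - prox t f v)"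
      using proximal_subgradient[OF t_pos \<rho>] by blast
    with \<rho>(1) show ?thesis
      unfolding subgradient_def by blast
  qed
  ultimately show "drs_splitting (epigraph_on UNIV f) (\<lambda>x. X ** A *v x) (X *v b) t (prox t f)"
    using t_pos by unfold_locales
qed

lemma F_DRS_eq: "F_DRS f A b t = F"
  by (simp add: fun_eq_iff F_def F_DRS_def affine_proj_def matrix_vector_mult_diff_distrib
      matrix_vector_mul_assoc)

lemma A_N: "A *v (X ** A *v x) = A *v x"
  by (simp add: matrix_vector_mul_assoc matrix_mul_assoc pseudoinverse_penrose)

text \<open>Consistency of the system enters here: for \<open>b = A *v x\<close> the first Penrose
  equation returns \<open>b\<close>.\<close>

lemma A_a: "A *v (X *v b) = b"
  using feasible A_N by (auto simp: solution_set_def simp flip: matrix_vector_mul_assoc)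

lemma not_MInf: "f x \<noteq> -\<infinity>"
  using f by (simp add: closed_convex_proper_on_def)

lemma effdom_eq: "effdom = effective_domain f"
proof (intro equalityI subsetI)
  fix x assume "x \<in> effdom"
  then obtain r where "f x \<le> ereal r"
    unfolding effdom_def by (auto simp: epigraph_on_def)
  then show "x \<in> effective_domain f"
    by (cases "f x") (auto simp: effective_domain_def)
next
  fix x assume "x \<in> effective_domain f"
  then obtain r where "f x = ereal r"
    using not_MInf[of x] by (cases "f x") (auto simp: effective_domain_def)
  then have "(x, r) \<in> epigraph_on UNIV f"
    by (simp add: epigraph_on_def)
  then show "x \<in> effdom"
    unfolding effdom_def by force
qed

lemma conjugate_dom_eq: "conjugate_dom = effective_domain (conjugate f)"
proof (intro equalityI subsetI)
  fix u assume "u \<in> conjugate_dom"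
  then obtain M where M: "\<And>x r. (x, r) \<in> epigraph_on UNIV f \<Longrightarrow> u \<bullet> x - r \<le> M"
    unfolding conjugate_dom_def by blast
  have "conjugate f u \<le> ereal M"
    unfolding conjugate_def
  proof (rule SUP_least)
    fix x assume "x \<in> effective_domain f"
    then obtain r where "f x = ereal r"
      using not_MInf[of x] by (cases "f x") (auto simp: effective_domain_def)
    then show "ereal (u \<bullet> x) - f x \<le> ereal M"
      using M[of x r] by (simp add: epigraph_on_def)
  qed
  then show "u \<in> effective_domain (conjugate f)"
    by (auto simp: effective_domain_def intro: le_less_trans)
next
  fix u assume "u \<in> effective_domain (conjugate f)"
  then obtain M where M: "conjugate f u \<le> ereal M"
    by (cases "conjugate f u") (auto simp: effective_domain_def)
  have "u \<bullet> x - r \<le> M" if "(x, r) \<in> epigraph_on UNIV f" for x r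
  proof -
    have fx: "f x \<le> ereal r"
      using that by (simp add: epigraph_on_def)
    then have "x \<in> effective_domain f"
      by (auto simp: effective_domain_def intro: le_less_trans)
    then have "ereal (u \<bullet> x) - f x \<le> conjugate f u"
      unfolding conjugate_def by (rule SUP_upper)
    moreover have "ereal (u \<bullet> x) - ereal r \<le> ereal (u \<bullet> x) - f x"
      using fx by (intro ereal_minus_mono) auto
    ultimately have "ereal (u \<bullet> x) - ereal r \<le> ereal M"
      using M by (meson order_trans)
    then show ?thesis by simp
  qed
  then show "u \<in> conjugate_dom"
    unfolding conjugate_dom_def by blast
qed

text \<open>On the solution set \<open>X *v b = X ** A *v y\<close>, so a gap is the image of
  \<open>x - y\<close> under the projector and no longer than \<open>x - y\<close>.\<close>

lemma setdist_primal:
  "setdist (effective_domain f) (solution_set A b) = norm (least_norm primal_gaps)"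
proof (rule setdist_eq_least_norm)
  show "effective_domain f \<noteq> {}"
    using effdom_nonempty effdom_eq by simp
  show "\<exists>c\<in>primal_gaps. norm c \<le> dist x y"
    if "x \<in> effective_domain f" "y \<in> solution_set A b" for x y
  proof
    show "X ** A *v x - X *v b \<in> primal_gaps"
      using that unfolding primal_gaps_def effdom_eq by blast
    have "X *v b = X ** A *v y"
      using that by (auto simp: solution_set_def simp flip: matrix_vector_mul_assoc)
    then have "X ** A *v x - X *v b = X ** A *v (x - y)"
      by (simp add: matrix_vector_mult_diff_distrib)
    then show "norm (X ** A *v x - X *v b) \<le> dist x y"
      using norm_N_le[of "x - y"] by (simp add: dist_norm)
  qed
  show "\<exists>x\<in>effective_domain f. \<exists>y\<in>solution_set A b. dist x y = norm c"
    if c: "c \<in> primal_gaps" for c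
  proof -
    obtain x where x: "x \<in> effective_domain f" "c = X ** A *v x - X *v b"
      using c unfolding primal_gaps_def effdom_eq by blast
    \<comment> \<open>\<open>x - c\<close> is the projection of \<open>x\<close> onto the solution
      set.\<close>
    have "A *v (x - c) = b"
      by (simp add: x A_N A_a matrix_vector_mult_diff_distrib)
    then show ?thesis
      using x(1) by (intro bexI[of _ x] bexI[of _ "x - c"]) (auto simp: solution_set_def dist_norm)
  qed
qed (fact feasible convex_gaps gaps_nonempty)+

lemma setdist_dual:
  "setdist (effective_domain (conjugate f)) (range_transpose A) = norm (least_norm dual_gaps)"
proof (rule setdist_eq_least_norm)
  show "effective_domain (conjugate f) \<noteq> {}"
    using conjugate_dom_nonempty conjugate_dom_eq by simp
  show "range_transpose A \<noteq> {}"
    by (simp add: range_transpose_def)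
  \<comment> \<open>This form shows that \<open>X ** A\<close> maps into the range of
    \<open>transpose A\<close>; \<open>fixed\<close> shows that it is the identity there.\<close>
  have N_T: "X ** A = transpose A ** transpose X"
    by (metis matrix_transpose_mul pseudoinverse_penrose(4))
  have fixed: "X ** A *v y = y" if "y \<in> range_transpose A" for y
  proof -
    have "X ** A ** transpose A = transpose (A ** (X ** A))"
      by (metis matrix_transpose_mul pseudoinverse_penrose(4))
    also have "A ** (X ** A) = A"
      by (simp add: matrix_mul_assoc pseudoinverse_penrose)
    finally show ?thesis
      using that by (auto simp: range_transpose_def matrix_vector_mul_assoc
          simp del: transpose_matrix_vector)
  qed
  show "\<exists>c\<in>dual_gaps. norm c \<le> dist u y"
    if "u \<in> effective_domain (conjugate f)" "y \<in> range_transpose A" for u y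
  proof
    show "u - X ** A *v u \<in> dual_gaps"
      using that unfolding dual_gaps_def conjugate_dom_eq by blast
    have "u - X ** A *v u = (u - y) - X ** A *v (u - y)"
      using fixed[OF that(2)] by (simp add: matrix_vector_mult_diff_distrib)
    then show "norm (u - X ** A *v u) \<le> dist u y"
      by (metis dist_norm norm_complement_le)
  qed
  show "\<exists>u\<in>effective_domain (conjugate f). \<exists>y\<in>range_transpose A. dist u y = norm c"
    if c: "c \<in> dual_gaps" for c
  proof -
    obtain u where u: "u \<in> effective_domain (conjugate f)" "c = u - X ** A *v u"
      using c unfolding dual_gaps_def conjugate_dom_eq by blast
    have "X ** A *v u \<in> range_transpose A"
      unfolding range_transpose_def N_T by (simp flip: matrix_vector_mul_assoc)
    then show ?thesis
      using u by (intro bexI[of _ u] bexI[of _ "X ** A *v u"]) (auto simp: dist_norm)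
  qed
qed (fact convex_gaps gaps_nonempty)+

text \<open>From a feasible point the recession direction preserves \<open>A *v x = b\<close> and
  lowers \<open>f\<close> at a positive rate.\<close>

lemma unbounded_if_feasible:
  assumes "\<not> infeasible f A b" "dual_strongly_infeasible f A"
  shows "unbounded f A b"
proof -
  obtain x where "x \<in> effdom" and x: "A *v x = b"
    using assms(1) by (auto simp: infeasible_def effdom_eq solution_set_def)
  then obtain r where r: "(x, r) \<in> epigraph_on UNIV f"
    unfolding effdom_def by auto
  have nonzero: "least_norm dual_gaps \<noteq> 0"
    using assms(2) by (auto simp: dual_strongly_infeasible_def setdist_dual)
  obtain d \<sigma> where d: "\<sigma> > 0" "X ** A *v d = 0"
    "\<forall>x r s. (x, r) \<in> epigraph_on UNIV f \<longrightarrow> s \<ge> 0 \<longrightarrow> (x + s *\<^sub>R d, r - s * \<sigma>) \<in> epigraph_on UNIV f"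
    by (rule recession_descent[OF nonzero])
  have "A *v d = 0"
    using A_N[of d] d(2) by simp
  have "(INF x\<in>solution_set A b. f x) \<le> ereal B" for B
  proof -
    \<comment> \<open>A step length that brings the height \<open>r\<close> down to \<open>B\<close>
      or below at rate \<open>\<sigma>\<close>.\<close>
    define s where "s = max 0 ((r - B) / \<sigma>)"
    have "s * \<sigma> \<ge> r - B"
      using d(1) unfolding s_def by (simp add: max_def field_simps)
    moreover have "f (x + s *\<^sub>R d) \<le> ereal (r - s * \<sigma>)"
      using d(3)[rule_format, OF r, of s] by (simp add: s_def epigraph_on_def)
    ultimately have "f (x + s *\<^sub>R d) \<le> ereal B"
      by (auto intro: order_trans)
    moreover have "x + s *\<^sub>R d \<in> solution_set A b"
      using x \<open>A *v d = 0\<close> by (simp add: solution_set_def matrix_vector_right_distrib matrix_vector_mult_scaleR)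
    ultimately show ?thesis
      by (intro INF_lower2)
  qed
  then show ?thesis
    unfolding unbounded_def using assms(1) by (auto intro: ereal_bot)
qed

lemma displacement_nonzero:
  assumes "pathological f A b" shows "displacement \<noteq> 0"
proof
  assume "displacement = 0"
  then have "t\<^sup>2 * (norm (least_norm dual_gaps))\<^sup>2 + (norm (least_norm primal_gaps))\<^sup>2 = 0"
    using norm_displacement by simp
  then have "least_norm dual_gaps = 0" "least_norm primal_gaps = 0"
    using t_pos by (auto simp: add_nonneg_eq_0_iff)
  then show False
    using assms by (simp add: pathological_def primal_strongly_infeasible_def
        dual_strongly_infeasible_def setdist_primal setdist_dual)
qed

text \<open>The projector isolates the primal gap in the residual, and \<open>A\<close> turns this
  gap into \<open>A *v prox t f (v k) - b\<close>.\<close>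

lemma residual_tendsto:
  assumes "(\<lambda>k. v k - F (v k)) \<longlonglongrightarrow> displacement"
  shows "(\<lambda>k. A *v prox t f (v k)) \<longlonglongrightarrow> b + A *v least_norm primal_gaps"
proof -
  have "(\<lambda>k. A *v (X ** A *v (v k - F (v k)))) \<longlonglongrightarrow> A *v (X ** A *v displacement)"
    by (intro bounded_linear.tendsto[OF matrix_vector_mul_bounded_linear] assms)
  then have "(\<lambda>k. A *v prox t f (v k) - b) \<longlonglongrightarrow> A *v least_norm primal_gaps"
    unfolding N_residual N_displacement
    by (simp add: matrix_vector_mult_diff_distrib A_N A_a)
  from tendsto_add[OF tendsto_const[of b] this] show ?thesis
    by simp
qed

end

section \<open>The limit of the iterate differences and its two cases\<close>

theorem theorem4p5:
  fixes blk :: "'n::finite \<Rightarrow> 'b::finite"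
    and fs :: "'b \<Rightarrow> real^'n \<Rightarrow> ereal"
    and f :: "real^'n \<Rightarrow> ereal"
    and A :: "real^'n^'m::finite"
    and b :: "real^'m"
    and v0 :: "real^'n"
    and t \<eta> D \<epsilon> :: real
    and R Mmax :: nat
    and v :: "nat \<Rightarrow> real^'n"
  assumes "\<And>i. closed_convex_proper_on (block_space blk i) (fs i)"
    and "f = separable_sum blk fs"
    and "solution_set A b \<noteq> {}"
    and "pathological f A b"
    and "t > 0" and "\<eta> > 0" and "D > 0" and "\<epsilon> > 0" and "R \<ge> 1"
    and "a2dr_run f A b v0 t \<eta> D \<epsilon> R Mmax v"
  shows "\<exists>\<delta>v. \<delta>v \<noteq> 0 \<and> (\<lambda>k. v k - v (k + 1)) \<longlonglongrightarrow> \<delta>v \<and>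
    (if (\<lambda>k. A *v prox t f (v k)) \<longlonglongrightarrow> b
     then (\<not> primal_weakly_infeasible f A b \<longrightarrow> unbounded f A b) \<and>
          norm \<delta>v = t * setdist (effective_domain (conjugate f)) (range_transpose A)
     else infeasible f A b \<and>
          norm \<delta>v \<ge> setdist (effective_domain f) (solution_set A b) \<and>
          (dual_feasible f A \<longrightarrow>
             norm \<delta>v = setdist (effective_domain f) (solution_set A b)))"
proof -
  interpret drs_problem f A b t
    using assms(3,5) closed_convex_proper_separable_sum[OF assms(1)] unfolding assms(2)
    by unfold_locales
  let ?p = "least_norm primal_gaps" and ?q = "least_norm dual_gaps"
  have nonzero: "displacement \<noteq> 0"
    by (rule displacement_nonzero[OF assms(4)])
  have "norm displacement > 0"
    using nonzero by simp
  then obtain K where K: "\<And>k. k \<ge> K \<Longrightarrow> v (Suc k) = F (v k)"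
    using a2dr_eventually_drs[OF assms(10,8,9), unfolded F_DRS_eq] norm_displacement_le by blast
  have "v (k + K) = (F ^^ k) (v K)" for k
    by (induction k) (use K in auto)
  then have "(\<lambda>k. v (k + K) - v (k + K + 1)) \<longlonglongrightarrow> displacement"
    using orbit_steps_tendsto[of "v K"] by (metis (no_types, lifting) Suc_eq_plus1 add_Suc ext)
  then have lim: "(\<lambda>k. v k - v (k + 1)) \<longlonglongrightarrow> displacement"
    by (rule LIMSEQ_offset)
  have "\<forall>\<^sub>F k in sequentially. v k - v (k + 1) = v k - F (v k)"
    using K by (intro eventually_sequentiallyI[of K]) simp
  with lim have "(\<lambda>k. v k - F (v k)) \<longlonglongrightarrow> displacement"
    by (rule Lim_transform_eventually)
  then have res: "(\<lambda>k. A *v prox t f (v k)) \<longlonglongrightarrow> b + A *v ?p"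
    by (rule residual_tendsto)
  \<comment> \<open>\<open>?p\<close> is fixed by the projector, so applying \<open>X\<close> to
    \<open>A *v ?p\<close> recovers it.\<close>
  have "?p = 0" if "A *v ?p = 0"
    using that N_least_norm(1) by (metis matrix_vector_mul_assoc matrix_vector_mult_0_right)
  moreover have "A *v ?p = 0" if "(\<lambda>k. A *v prox t f (v k)) \<longlonglongrightarrow> b"
    using LIMSEQ_unique[OF res that] by simp
  ultimately have iff: "(\<lambda>k. A *v prox t f (v k)) \<longlonglongrightarrow> b \<longleftrightarrow> ?p = 0"
    using res by auto
  show ?thesis
  proof (rule exI[of _ displacement], intro conjI nonzero lim)
    show "if (\<lambda>k. A *v prox t f (v k)) \<longlonglongrightarrow> b
     then (\<not> primal_weakly_infeasible f A b \<longrightarrow> unbounded f A b) \<and>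
          norm displacement = t * setdist (effective_domain (conjugate f)) (range_transpose A)
     else infeasible f A b \<and>
          norm displacement \<ge> setdist (effective_domain f) (solution_set A b) \<and>
          (dual_feasible f A \<longrightarrow>
             norm displacement = setdist (effective_domain f) (solution_set A b))"
    proof (cases "?p = 0")
      case True
      \<comment> \<open>The primal distance is \<open>0\<close>, so the pathology must be dual;
        outside weak infeasibility the problem is then feasible.\<close>
      then have strong: "\<not> primal_strongly_infeasible f A b"
        by (simp add: primal_strongly_infeasible_def setdist_primal)
      then have "dual_strongly_infeasible f A"
        using assms(4) by (simp add: pathological_def)
      then have "\<not> primal_weakly_infeasible f A b \<longrightarrow> unbounded f A b"
        using strong unbounded_if_feasible by (auto simp: primal_weakly_infeasible_def)
      moreover have "(norm displacement)\<^sup>2 = (t * norm ?q)\<^sup>2"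
        using True by (simp add: norm_displacement power_mult_distrib)
      then have "norm displacement = t * norm ?q"
        by (rule power2_eq_imp_eq) (use t_pos in auto)
      ultimately show ?thesis
        using True iff by (simp add: setdist_dual)
    next
      case False
      have "infeasible f A b"
      proof (rule ccontr)
        assume "\<not> ?thesis"
        then obtain x where "x \<in> effective_domain f" "x \<in> solution_set A b"
          by (auto simp: infeasible_def)
        then have "setdist (effective_domain f) (solution_set A b) \<le> 0"
          using setdist_le_dist by fastforce
        then show False
          using False by (simp add: setdist_primal)
      qed
      moreover have "(norm ?p)\<^sup>2 \<le> (norm displacement)\<^sup>2"
        by (simp add: norm_displacement)
      then have "norm ?p \<le> norm displacement"
        by simp
      moreover have "norm displacement = norm ?p" if "dual_feasible f A"
      proof -
        obtain u where "u \<in> effective_domain (conjugate f)" "u \<in> range_transpose A"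
          using \<open>dual_feasible f A\<close> by (auto simp: dual_feasible_def)
        \<comment> \<open>A common point makes the dual distance \<open>0\<close>, so only the
          primal part of \<open>displacement\<close> remains.\<close>
        then have "norm ?q \<le> 0"
          unfolding setdist_dual[symmetric] using setdist_le_dist by fastforce
        then have "(norm displacement)\<^sup>2 = (norm ?p)\<^sup>2"
          by (simp add: norm_displacement)
        then show ?thesis
          by (rule power2_eq_imp_eq) auto
      qed
      ultimately show ?thesis
        using False iff by (simp add: setdist_primal)
    qed
  qed
qed

end
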